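(* Let $\Omega\subset\mathbb{R}^n$ be a bounded $\mu$-measurable set, where $\mu$ is a lower Ahlfors $\beta$-regular measure in $\Omega$, let $0\le\alpha<\beta$, and let $p$ be a log-Hölder continuous exponent on $\Omega$ such that $1<p_*\le p(x)\le p^*<\beta/\alpha$ for all $x\in\Omega$. Define $q$ and $s$ on $\Omega$ by $$\frac1{q(x)}=\frac1{p(x)}-\frac{\alpha}{\beta},\qquad s(x)=1+\frac{q(x)}{p'(x)}.$$ Let $r\in(1,s^* )$ and $\epsilon>0$, and let $w$ be a weight on $\Omega$ such that $w(\cdot)^{q(\cdot)}\in A_{r-\delta}(\Omega)$ for some $\delta$ with $0<\delta\le r-1$. Then there exists a positive constant $C$ such that $$\|w\,M_\alpha f\|_{q(\cdot),\Omega^{s}_{r,\epsilon}}\le C\,\|w f\|_{p(\cdot),\Omega^{s}_{r,\epsilon}}$$ for every function $f$ such that $wf\in L^{p(\cdot)}(\Omega^{s}_{r,\epsilon})$ and $\mathrm{supp}\,f\subset\Omega^{s}_{r,\epsilon}$.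
   Context: $\mu$ is a non-negative Borel regular measure on $\mathbb{R}^n$. $Q=Q(x,l(Q))$ denotes a cube centered at $x$ with side length $l(Q)$ and sides parallel to the coordinate axes; $B(x,\epsilon)$ is the Euclidean ball. The measure $\mu$ is lower Ahlfors $\beta$-regular in the bounded set $\Omega$ ($\beta>0$ a constant) if there is $c>0$ with $\mu(Q(x,l(Q)))\ge c\,l(Q)^{\beta}$ for every $x\in\Omega$ and every cube $Q=Q(x,l(Q))$ with $0<l(Q)<\mathrm{diam}(\Omega)$. An exponent is a $\mu$-measurable function $p:\Omega\to[1,\infty)$. For a function $t$ on $\Omega$ write $t_*=\inf_\Omega t$, $t^*=\sup_\Omega t$. When $p_*>1$, $p'$ is defined by $1/p(x)+1/p'(x)=1$. An exponent $p$ is log-Hölder continuous if there is $C>0$ with $|p(x)-p(y)|\le C/\log(1/|x-y|)$ for all $x,y\in\Omega$ with $|x-y|\le 1/2$. When $\alpha=0$, $\beta/\alpha$ means $\infty$. For $\mu$-measurable $f$ and a measurable set $E\subset\Omega$, $\rho_{p(\cdot),E}(f)=\int_E|f(x)|^{p(x)}\,d\mu(x)$ and $\|f\|_{p(\cdot),E}=\inf\{\lambda>0:\rho_{p(\cdot),E}(f/\lambda)\le1\}$. $L^{p(\cdot)}(E)$ is the set of $\mu$-measurable $f$ supported in $E$ with $\|f\|_{p(\cdot),E}<\infty$. Functions on $\Omega$ are extended by $0$ outside $\Omega$. The centered fractional maximal function is $$M_\alpha f(x)=\sup_{\rho>0}\frac{1}{\mu(Q(x,\rho))^{1-\alpha/\beta}}\int_{Q(x,\rho)}|f(y)|\,d\mu(y).$$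 A weight on $\Omega$ is a $\mu$-measurable function $w$ with $0<w<\infty$ $\mu$-a.e. For $1<\sigma<\infty$, a weight $v$ belongs to $A_\sigma(\Omega)$ if there is $C>0$ with $$\Big(\frac1{\mu(Q)}\int_{Q\cap\Omega}v\,d\mu\Big)\Big(\frac1{\mu(Q)}\int_{Q\cap\Omega}v^{-1/(\sigma-1)}\,d\mu\Big)^{\sigma-1}\le C$$ for each cube $Q$ centered at a point of $\Omega$. $v\in A_1(\Omega)$ means that there is $C>0$ with $\frac1{\mu(Q)}\int_{Q\cap\Omega}v\,d\mu\le C\,v(x)$ for $\mu$-a.e. $x\in Q\cap\Omega$ and each cube $Q$ centered at a point of $\Omega$. For a continuous function $t$ on $\Omega$, $r\in\mathbb{R}$ and $\epsilon>0$, put $\Omega_r^t=\{x\in\Omega:t(x)>r\}$ and $\Omega_{r,\epsilon}^t=\Omega_r^t\setminus\bigcup_{x\in\Omega\setminus\Omega_r^t}B(x,\epsilon)$.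
   Formalization: The measure μ is additionally assumed finite on every cube centred at a point of Ω; without this the averages over cubes of infinite measure are undefined, and with 1/∞ = 0 the claim fails. *)

theory Defs
  imports "HOL-Analysis.Analysis"
begin

text \<open>
  Real powers on \<open>[0, \<infinity>]\<close>. Only positive exponents are used below, so that
  \<open>0\<close> and \<open>\<infinity>\<close> are fixed.
\<close>
definition epowr :: "ennreal \<Rightarrow> real \<Rightarrow> ennreal" where
  "epowr x a = (if x = \<infinity> then \<infinity> else ennreal (enn2real x powr a))"

text \<open>
  \<open>sets \<mu>\<close> plays the role of the sigma-algebra of \<open>\<mu>\<close>-measurable sets. It contains the
  Borel sets (hence \<open>space \<mu> = UNIV\<close>) and is complete, like the sigma-algebra of
  Caratheodory-measurable sets of a Borel regular outer measure.
\<close>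
definition borel_regular :: "(real ^ 'n) measure \<Rightarrow> bool" where
  "borel_regular \<mu> \<longleftrightarrow>
     sets borel \<subseteq> sets \<mu> \<and> complete_measure \<mu> \<and>
     (\<forall>A\<in>sets \<mu>. \<exists>B\<in>sets borel. A \<subseteq> B \<and> emeasure \<mu> B = emeasure \<mu> A)"

definition cube :: "real ^ 'n \<Rightarrow> real \<Rightarrow> (real ^ 'n) set" where
  "cube x l = box (\<chi> i. x $ i - l / 2) (\<chi> i. x $ i + l / 2)"

definition lower_ahlfors :: "(real ^ 'n) measure \<Rightarrow> real \<Rightarrow> (real ^ 'n) set \<Rightarrow> bool" where
  "lower_ahlfors \<mu> \<beta> \<Omega> \<longleftrightarrow>
     (\<exists>c>0. \<forall>x\<in>\<Omega>. \<forall>l. 0 < l \<and> l < diameter \<Omega> \<longrightarrow>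
        ennreal (c * l powr \<beta>) \<le> emeasure \<mu> (cube x l))"

definition exponent_on :: "(real ^ 'n) measure \<Rightarrow> (real ^ 'n) set \<Rightarrow> (real ^ 'n \<Rightarrow> real) \<Rightarrow> bool" where
  "exponent_on \<mu> \<Omega> p \<longleftrightarrow>
     p \<in> borel_measurable (restrict_space \<mu> \<Omega>) \<and> (\<forall>x\<in>\<Omega>. 1 \<le> p x)"

text \<open>For \<open>x = y\<close> the inequality below reads \<open>0 \<le> 0\<close>, since \<open>1 / 0 = 0\<close> and \<open>ln 0 = 0\<close>.\<close>
definition log_hoelder_on :: "(real ^ 'n) set \<Rightarrow> (real ^ 'n \<Rightarrow> real) \<Rightarrow> bool" where
  "log_hoelder_on \<Omega> p \<longleftrightarrow>
     (\<exists>C>0. \<forall>x\<in>\<Omega>. \<forall>y\<in>\<Omega>. dist x y \<le> 1 / 2 \<longrightarrow> \<bar>p x - p y\<bar> \<le> C / ln (1 / dist x y))"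

text \<open>
  The modular and the Luxemburg norm depend on a function only through its modulus; they take
  this modulus as a \<open>[0, \<infinity>]\<close>-valued argument because maximal functions may be infinite.
  The norm is \<open>\<infinity>\<close> when no admissible \<open>\<lambda>\<close> exists.
\<close>
definition modular ::
  "(real ^ 'n) measure \<Rightarrow> (real ^ 'n \<Rightarrow> real) \<Rightarrow> (real ^ 'n) set \<Rightarrow> (real ^ 'n \<Rightarrow> ennreal) \<Rightarrow> ennreal"
  where "modular \<mu> p E g = (\<integral>\<^sup>+x\<in>E. epowr (g x) (p x) \<partial>\<mu>)"

definition lux_norm ::
  "(real ^ 'n) measure \<Rightarrow> (real ^ 'n \<Rightarrow> real) \<Rightarrow> (real ^ 'n) set \<Rightarrow> (real ^ 'n \<Rightarrow> ennreal) \<Rightarrow> ennreal"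
  where "lux_norm \<mu> p E g =
    Inf {ennreal l | l. 0 < l \<and> modular \<mu> p E (\<lambda>x. g x / ennreal l) \<le> 1}"

definition Lp_var ::
  "(real ^ 'n) measure \<Rightarrow> (real ^ 'n \<Rightarrow> real) \<Rightarrow> (real ^ 'n) set \<Rightarrow> (real ^ 'n \<Rightarrow> real) set"
  where "Lp_var \<mu> p E =
    {f \<in> borel_measurable \<mu>. {x. f x \<noteq> 0} \<subseteq> E \<and> lux_norm \<mu> p E (\<lambda>x. ennreal \<bar>f x\<bar>) < \<infinity>}"

definition frac_maximal ::
  "(real ^ 'n) measure \<Rightarrow> real \<Rightarrow> real \<Rightarrow> (real ^ 'n \<Rightarrow> real) \<Rightarrow> real ^ 'n \<Rightarrow> ennreal"
  where "frac_maximal \<mu> \<beta> \<alpha> f x =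
    (SUP \<rho>\<in>{0<..}. (\<integral>\<^sup>+y\<in>cube x \<rho>. ennreal \<bar>f y\<bar> \<partial>\<mu>)
                      / epowr (emeasure \<mu> (cube x \<rho>)) (1 - \<alpha> / \<beta>))"

definition weight_on :: "(real ^ 'n) measure \<Rightarrow> (real ^ 'n) set \<Rightarrow> (real ^ 'n \<Rightarrow> real) \<Rightarrow> bool" where
  "weight_on \<mu> \<Omega> w \<longleftrightarrow>
     w \<in> borel_measurable (restrict_space \<mu> \<Omega>) \<and> (AE x in \<mu>. x \<in> \<Omega> \<longrightarrow> 0 < w x)"

text \<open>The class \<open>A\<^sub>\<sigma>(\<Omega>)\<close> for \<open>1 \<le> \<sigma> < \<infinity>\<close>.\<close>
definition muckenhoupt ::
  "(real ^ 'n) measure \<Rightarrow> (real ^ 'n) set \<Rightarrow> real \<Rightarrow> (real ^ 'n \<Rightarrow> real) \<Rightarrow> bool"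
  where "muckenhoupt \<mu> \<Omega> \<sigma> v \<longleftrightarrow> weight_on \<mu> \<Omega> v \<and>
    (if \<sigma> = 1 then
       (\<exists>C>0. \<forall>z\<in>\<Omega>. \<forall>l>0.
          AE x in \<mu>. x \<in> cube z l \<inter> \<Omega> \<longrightarrow>
            (\<integral>\<^sup>+y\<in>cube z l \<inter> \<Omega>. ennreal (v y) \<partial>\<mu>) / emeasure \<mu> (cube z l) \<le> ennreal (C * v x))
     else
       (\<exists>C>0. \<forall>z\<in>\<Omega>. \<forall>l>0.
          ((\<integral>\<^sup>+y\<in>cube z l \<inter> \<Omega>. ennreal (v y) \<partial>\<mu>) / emeasure \<mu> (cube z l))
          * epowr ((\<integral>\<^sup>+y\<in>cube z l \<inter> \<Omega>. ennreal (v y powr (- 1 / (\<sigma> - 1))) \<partial>\<mu>)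
                     / emeasure \<mu> (cube z l)) (\<sigma> - 1)
          \<le> ennreal C))"

definition superlevel :: "(real ^ 'n) set \<Rightarrow> (real ^ 'n \<Rightarrow> real) \<Rightarrow> real \<Rightarrow> (real ^ 'n) set" where
  "superlevel \<Omega> t r = {x \<in> \<Omega>. r < t x}"

definition superlevel_eps ::
  "(real ^ 'n) set \<Rightarrow> (real ^ 'n \<Rightarrow> real) \<Rightarrow> real \<Rightarrow> real \<Rightarrow> (real ^ 'n) set"
  where "superlevel_eps \<Omega> t r \<epsilon> = superlevel \<Omega> t r - (\<Union>x\<in>\<Omega> - superlevel \<Omega> t r. ball x \<epsilon>)"

end

theory Submission
  imports Defs
begin

text \<open>
  Write \<open>a = \<alpha> / \<beta>\<close> and \<open>v = w\<^sup>q\<close>, let \<open>\<nu>\<close> be the measure \<open>v d\<mu>\<close> on \<open>\<Omega>\<close>, put \<open>\<sigma> = r - \<delta>\<close>, and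
  let \<open>E\<close> be the set on which the norms are taken. Then \<open>v\<close> belongs to \<open>A\<^sub>\<sigma>\<close> and
  \<open>\<sigma> < r < s\<close> on \<open>E\<close>. This gap between the class of the weight and the exponent \<open>s\<close> does the work
  that self-improvement of the Muckenhoupt class does at the endpoint \<open>\<sigma> = s\<close>, so no reverse Hoelder
  inequality is involved and \<open>\<mu>\<close> need not be doubling.

  The fractional order disappears first. Since \<open>1 / q = 1 / p - a\<close>, one has \<open>s = q (1 - a)\<close>. If
  \<open>\<integral>\<^sub>E (w \<bar>f\<bar>)\<^sup>p d\<mu> \<le> 1\<close>, put \<open>F = (w \<bar>f\<bar>)\<^sup>p / v\<close> and let \<open>G = F\<close> to the power \<open>1 / s\<close>. The pointwise
  identity \<open>fractional_factorisation\<close> says that \<open>\<bar>f\<bar>\<close> is the product of \<open>F v\<close> to the power \<open>a\<close> and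
  \<open>G\<close> to the power \<open>1 - a\<close>. As \<open>\<integral> F v d\<mu> \<le> 1\<close>, Hoelder's inequality bounds the \<open>q(x)\<close>-th power of the
  fractional maximal function by the \<open>s(x)\<close>-th power of the averages of \<open>G\<close>
  (\<open>scaled_fractional_maximal_le\<close>), while \<open>\<integral> G\<^sup>s d\<nu> \<le> 1\<close>.

  Next the exponent is frozen on each cube \<open>Q\<close> centred at \<open>x\<close>. The part of \<open>G\<close> below \<open>1\<close> has averages at
  most \<open>1\<close>. For the part above \<open>1\<close> the condition \<open>A\<^sub>\<sigma>\<close>, applied to a cube containing \<open>\<Omega>\<close>, bounds its
  integral, so that its average over \<open>Q\<close> is at most \<open>A / \<mu>(Q)\<close>. The lower Ahlfors bound for \<open>\<mu>(Q)\<close> and the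
  log-Hoelder continuity of \<open>s\<close> then permit replacing the exponent \<open>s(x)\<close> by a lower bound of \<open>s\<close> on \<open>Q\<close>
  at the cost of a constant factor (\<open>log_hoelder_lower_ahlfors\<close>). The condition \<open>A\<^sub>\<sigma>\<close> on \<open>Q\<close> and
  Jensen's inequality turn the \<open>\<mu>\<close>-average into a \<open>\<nu>\<close>-average: \<open>(M G)\<^sup>s \<le> B (1 + (M\<^sub>\<nu> K)\<^sup>t)\<close> on \<open>E\<close>, where
  \<open>t = r / \<sigma> > 1\<close> is a constant and \<open>K\<^sup>t \<le> G\<^sup>s\<close> (\<open>variable_maximal_pointwise\<close>).

  It remains to bound the centred maximal operator \<open>M\<^sub>\<nu>\<close> on \<open>L\<^sup>t(\<nu>)\<close> for an arbitrary finite measure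
  (\<open>strong_type\<close>). This rests on a covering theorem of Besicovitch type. For finitely many radii it is
  elementary: choose centres greedily in order of decreasing radius
  (\<open>besicovitch_selection\<close>); two chosen centres cannot lie in the same orthant around a common point of
  their cubes (\<open>separated_cubes_overlap\<close>). The bounds do not depend on the radii, hence pass to all radii.
\<close>

section \<open>Cubes and the selection of centres\<close>

lemma mem_cube: "y \<in> cube x l \<longleftrightarrow> (\<forall>i. \<bar>y $ i - x $ i\<bar> < l / 2)"
proof -
  have "x $ i - l / 2 < y $ i \<and> y $ i < x $ i + l / 2 \<longleftrightarrow> \<bar>y $ i - x $ i\<bar> < l / 2" for i
    by linarith
  then show ?thesis unfolding cube_def mem_box_cart by simp
qed

lemma open_cube [simp]: "open (cube x l)"
  unfolding cube_def by (rule open_box)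

lemma centre_in_cube [simp]: "0 < l \<Longrightarrow> x \<in> cube x l"
  by (simp add: mem_cube)

lemma mem_cube_commute: "y \<in> cube x l \<longleftrightarrow> x \<in> cube y l"
  by (simp add: mem_cube abs_minus_commute)

lemma cube_mono: "l \<le> m \<Longrightarrow> cube x l \<subseteq> cube x m"
  unfolding mem_cube subset_iff by (meson divide_right_mono less_le_trans zero_le_numeral)

lemma ball_subset_cube: "0 < l \<Longrightarrow> ball x (l / 2) \<subseteq> cube x l"
proof
  fix y assume "0 < l" "y \<in> ball x (l / 2)"
  then have "norm (y - x) < l / 2" by (simp add: dist_norm norm_minus_commute)
  moreover have "\<bar>(y - x) $ i\<bar> \<le> norm (y - x)" for i by (rule component_le_norm_cart)
  ultimately show "y \<in> cube x l" unfolding mem_cube by (metis le_less_trans vector_minus_component)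
qed

lemma dist_le_of_mem_cube:
  fixes x :: "real ^ 'n"
  assumes "y \<in> cube x l"
  shows "dist x y \<le> real CARD('n) * (l / 2)"
proof -
  have "dist x y \<le> (\<Sum>i\<in>UNIV. \<bar>(y - x) $ i\<bar>)"
    using norm_le_l1_cart[of "y - x"] by (simp add: dist_norm norm_minus_commute)
  also have "\<dots> \<le> (\<Sum>i\<in>(UNIV::'n set). l / 2)"
    by (rule sum_mono) (use assms in \<open>auto simp: mem_cube intro: less_imp_le\<close>)
  finally show ?thesis by simp
qed

lemma cube_increasing_limit:
  assumes "incseq \<rho>" "\<And>k. \<rho> k < l" "\<rho> \<longlonglongrightarrow> l"
  shows "cube x l = (\<Union>k. cube x (\<rho> k))"
proof
  show "(\<Union>k. cube x (\<rho> k)) \<subseteq> cube x l"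
    using cube_mono assms(2) by (meson UN_least less_imp_le)
  show "cube x l \<subseteq> (\<Union>k. cube x (\<rho> k))"
  proof
    fix y assume y: "y \<in> cube x l"
    define d where "d = Max (range (\<lambda>i. 2 * \<bar>y $ i - x $ i\<bar>))"
    have "d < l" unfolding d_def using y[unfolded mem_cube] by (subst Max_less_iff) (auto simp: mult.commute)
    then obtain k where k: "d < \<rho> k"
      using order_tendstoD(1)[OF assms(3)] by (auto simp: eventually_sequentially)
    have "2 * \<bar>y $ i - x $ i\<bar> \<le> d" for i unfolding d_def by (rule Max_ge) auto
    then have "2 * \<bar>y $ i - x $ i\<bar> < \<rho> k" for i using k le_less_trans by blast
    then have "\<bar>y $ i - x $ i\<bar> < \<rho> k / 2" for i by (simp add: field_simps)
    then have "y \<in> cube x (\<rho> k)" by (simp add: mem_cube)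
    then show "y \<in> (\<Union>k. cube x (\<rho> k))" by blast
  qed
qed

text \<open>
  A set covered by \<open>k\<close> balls of radius \<open>b / 4\<close> has at most \<open>k\<close> points whose cubes of side \<open>b\<close> contain
  none of the other points, because each ball contains at most one. So a separated set of maximal
  cardinality exists, and maximality makes its cubes cover.
\<close>
lemma maximal_separated_centres:
  fixes A :: "(real ^ 'n) set"
  assumes "bounded A" "0 < b"
  shows "\<exists>S\<subseteq>A. finite S \<and> (\<forall>x\<in>S. \<forall>y\<in>S. x \<noteq> y \<longrightarrow> y \<notin> cube x b) \<and> A \<subseteq> (\<Union>x\<in>S. cube x b)"
proof -
  define sep where "sep S \<longleftrightarrow> S \<subseteq> A \<and> finite S \<and> (\<forall>x\<in>S. \<forall>y\<in>S. x \<noteq> y \<longrightarrow> y \<notin> cube x b)"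
    for S :: "(real ^ 'n) set"
  have cpt: "compact (closure A)" using assms(1) compact_closure by blast
  have cover: "closure A \<subseteq> (\<Union>x\<in>UNIV. ball x (b / 4))"
    using assms(2) by (intro subsetI UN_I[OF UNIV_I]) (rule centre_in_ball[THEN iffD2], simp)
  obtain T where T: "finite T" "closure A \<subseteq> (\<Union>x\<in>T. ball x (b / 4))"
    by (rule compactE_image[OF cpt _ cover]) auto
  have bound: "card S \<le> card T" if S: "sep S" for S
  proof -
    have "\<forall>x\<in>S. \<exists>c\<in>T. x \<in> ball c (b / 4)"
      using T(2) S closure_subset[of A] unfolding sep_def by blast
    then obtain h where h: "\<And>x. x \<in> S \<Longrightarrow> h x \<in> T \<and> x \<in> ball (h x) (b / 4)" by metis
    have "inj_on h S"
    proof (rule inj_onI, rule ccontr)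
      fix x y assume xy: "x \<in> S" "y \<in> S" "h x = h y" "x \<noteq> y"
      have "dist x y < b / 2"
        using h[OF xy(1)] h[OF xy(2)] xy(3) dist_triangle3[of x y "h x"] by (simp add: dist_commute)
      then have "y \<in> ball x (b / 2)" by simp
      then have "y \<in> cube x b" using ball_subset_cube[OF assms(2)] by blast
      then show False using S xy unfolding sep_def by blast
    qed
    then show ?thesis using card_inj_on_le[of h S T] h T(1) by blast
  qed
  have "sep {}" unfolding sep_def by simp
  then obtain S where S: "sep S" and max: "\<And>S'. sep S' \<Longrightarrow> card S' \<le> card S"
    using ex_has_greatest_nat[of sep "{}" card "card T + 1"] bound by force
  have "A \<subseteq> (\<Union>x\<in>S. cube x b)"
  proof (rule ccontr)
    assume "\<not> ?thesis"
    then obtain z where z: "z \<in> A" "\<And>x. x \<in> S \<Longrightarrow> z \<notin> cube x b" by blast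
    then have "z \<notin> S" using assms(2) centre_in_cube by blast
    moreover have "sep (insert z S)"
      using S z mem_cube_commute unfolding sep_def by (auto; blast)
    ultimately show False using max[of "insert z S"] S unfolding sep_def by simp
  qed
  then show ?thesis using S unfolding sep_def by blast
qed

text \<open>
  Induction on the largest radius: a maximal separated set of centres with that radius covers all
  centres of that radius, and the centres outside the cubes chosen so far have smaller radii. Hence a
  later centre never lies in an earlier cube, and an earlier centre not in a later one, whose side is
  shorter.
\<close>
lemma besicovitch_selection:
  fixes A :: "(real ^ 'n) set" and \<rho> :: "real ^ 'n \<Rightarrow> real"
  assumes "finite R" "\<And>b. b \<in> R \<Longrightarrow> 0 < b" "bounded A" "\<rho> ` A \<subseteq> R"
  shows "\<exists>S\<subseteq>A. finite S \<and> A \<subseteq> (\<Union>x\<in>S. cube x (\<rho> x)) \<and>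
    (\<forall>x\<in>S. \<forall>y\<in>S. x \<noteq> y \<longrightarrow> y \<notin> cube x (max (\<rho> x) (\<rho> y)))"
  using assms
proof (induction R arbitrary: A rule: finite_linorder_max_induct)
  case empty
  then show ?case by auto
next
  case (insert b R)
  define A1 where "A1 = {x \<in> A. \<rho> x = b}"
  have "bounded A1" using insert.prems(2) unfolding A1_def by (rule bounded_subset) auto
  then obtain S1 where S1: "S1 \<subseteq> A1" "finite S1" "\<forall>x\<in>S1. \<forall>y\<in>S1. x \<noteq> y \<longrightarrow> y \<notin> cube x b"
    "A1 \<subseteq> (\<Union>x\<in>S1. cube x b)"
    using maximal_separated_centres[of A1 b] insert.prems(1) by auto
  define A2 where "A2 = A - (\<Union>x\<in>S1. cube x b)"
  have "bounded A2" using insert.prems(2) unfolding A2_def by (rule bounded_subset) auto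
  moreover have "\<rho> ` A2 \<subseteq> R" using insert.prems(3) S1(4) unfolding A2_def A1_def by blast
  ultimately obtain S2 where S2: "S2 \<subseteq> A2" "finite S2" "A2 \<subseteq> (\<Union>x\<in>S2. cube x (\<rho> x))"
    "\<forall>x\<in>S2. \<forall>y\<in>S2. x \<noteq> y \<longrightarrow> y \<notin> cube x (max (\<rho> x) (\<rho> y))"
    using insert.IH[of A2] insert.prems(1) by blast
  have \<rho>1: "\<rho> x = b" if "x \<in> S1" for x using that S1(1) A1_def by auto
  have \<rho>2: "\<rho> x < b" if "x \<in> S2" for x
    using that S2(1) \<open>\<rho> ` A2 \<subseteq> R\<close> insert.hyps(2) by blast
  have cross: "y \<notin> cube x b \<and> x \<notin> cube y b" if "x \<in> S1" "y \<in> S2" for x y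
    using that S2(1) mem_cube_commute unfolding A2_def by blast
  have "y \<notin> cube x (max (\<rho> x) (\<rho> y))" if xy: "x \<in> S1 \<union> S2" "y \<in> S1 \<union> S2" "x \<noteq> y" for x y
  proof -
    consider "x \<in> S1" "y \<in> S1" | "x \<in> S1" "y \<in> S2" | "x \<in> S2" "y \<in> S1" | "x \<in> S2" "y \<in> S2"
      using xy by blast
    then show ?thesis
    proof cases
      case 1
      then show ?thesis using S1(3) \<rho>1 \<open>x \<noteq> y\<close> by simp
    next
      case 2
      then show ?thesis using cross \<rho>1 \<rho>2[of y] by (simp add: max_def)
    next
      case 3
      then show ?thesis using cross[of y x] \<rho>1[of y] \<rho>2[of x] by (simp add: max_def)
    next
      case 4
      then show ?thesis using S2(4) \<open>x \<noteq> y\<close> by blast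
    qed
  qed
  moreover have "A \<subseteq> (\<Union>x\<in>S1 \<union> S2. cube x (\<rho> x))"
    using S2(3) \<rho>1 unfolding A2_def by auto
  moreover have "S1 \<union> S2 \<subseteq> A" using S1(1) S2(1) A1_def A2_def by auto
  ultimately show ?case using S1(2) S2(2) by (intro exI[of _ "S1 \<union> S2"]) auto
qed

text \<open>
  If \<open>x\<close> and \<open>y\<close> lie in the same orthant around \<open>z\<close> and their cubes contain \<open>z\<close>, then each coordinate of
  \<open>y - x\<close> is a difference of two numbers of the same sign, both less than half the larger side in
  modulus. So each coordinate stays below that bound, contradicting the separation. There are
  \<open>2 ^ CARD('n)\<close> orthants.
\<close>
lemma separated_cubes_overlap:
  fixes S :: "(real ^ 'n) set"
  assumes "\<forall>x\<in>S. \<forall>y\<in>S. x \<noteq> y \<longrightarrow> y \<notin> cube x (max (\<rho> x) (\<rho> y))"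
  shows "card {x \<in> S. z \<in> cube x (\<rho> x)} \<le> 2 ^ CARD('n)"
proof -
  \<comment> \<open>The orthant of \<open>x\<close> around \<open>z\<close>, coded by its nonnegative coordinates.\<close>
  define h where "h x = {i. z $ i \<le> x $ i}" for x :: "real ^ 'n"
  have "inj_on h {x \<in> S. z \<in> cube x (\<rho> x)}"
  proof (rule inj_onI, rule ccontr)
    fix x y assume xy: "x \<in> {x \<in> S. z \<in> cube x (\<rho> x)}" "y \<in> {x \<in> S. z \<in> cube x (\<rho> x)}"
      "h x = h y" "x \<noteq> y"
    have "\<bar>y $ i - x $ i\<bar> < max (\<rho> x) (\<rho> y) / 2" for i
    proof -
      have "z $ i \<le> x $ i \<longleftrightarrow> z $ i \<le> y $ i" using xy(3) unfolding h_def by blast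
      moreover have "\<bar>z $ i - x $ i\<bar> < \<rho> x / 2" "\<bar>z $ i - y $ i\<bar> < \<rho> y / 2"
        using xy(1,2) by (auto simp: mem_cube)
      ultimately show ?thesis by (auto simp: max_def abs_if split: if_splits)
    qed
    then have "y \<in> cube x (max (\<rho> x) (\<rho> y))" by (simp add: mem_cube)
    then show False using assms xy by blast
  qed
  then have "card {x \<in> S. z \<in> cube x (\<rho> x)} \<le> card (Pow (UNIV :: 'n set))"
    by (rule card_inj_on_le) auto
  then show ?thesis by (simp add: card_Pow)
qed

section \<open>The weak type bound of the centred maximal operator\<close>

lemma borel_subset_sets:
  fixes \<nu> :: "(real ^ 'n) measure"
  assumes "sets borel \<subseteq> sets \<nu>"
  shows space_of_borel_subset: "space \<nu> = UNIV"
    and open_in_sets: "open U \<Longrightarrow> U \<in> sets \<nu>"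
    and ident_to_borel: "(\<lambda>x. x) \<in> borel_measurable \<nu>"
proof -
  have "UNIV \<in> sets \<nu>" using assms by (meson borel_open open_UNIV subsetD)
  then show sp: "space \<nu> = UNIV" using sets.sets_into_space by blast
  show "open U \<Longrightarrow> U \<in> sets \<nu>" using assms by (meson borel_open subsetD)
  show "(\<lambda>x. x) \<in> borel_measurable \<nu>" using assms sp by (intro measurableI) auto
qed

text \<open>
  The selected cubes cover \<open>A\<close>, and each point lies in at most \<open>2 ^ CARD('n)\<close> of them, so adding up the
  hypothesis over them gives a constant that depends neither on \<open>R\<close> nor on \<open>\<nu>\<close>.
\<close>
lemma weak_type_finite_radii:
  fixes \<nu> :: "(real ^ 'n) measure"
  assumes \<nu>: "sets borel \<subseteq> sets \<nu>" and K: "K \<in> borel_measurable \<nu>"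
    and R: "finite R" "\<And>b. b \<in> R \<Longrightarrow> 0 < b" and "bounded A"
    and A: "\<And>x. x \<in> A \<Longrightarrow> \<exists>b\<in>R. c * emeasure \<nu> (cube x b) \<le> (\<integral>\<^sup>+y\<in>cube x b. K y \<partial>\<nu>)"
  shows "c * emeasure \<nu> A \<le> 2 ^ CARD('n) * (\<integral>\<^sup>+y. K y \<partial>\<nu>)"
proof -
  obtain \<rho> where \<rho>: "\<And>x. x \<in> A \<Longrightarrow> \<rho> x \<in> R \<and>
      c * emeasure \<nu> (cube x (\<rho> x)) \<le> (\<integral>\<^sup>+y\<in>cube x (\<rho> x). K y \<partial>\<nu>)"
    using A by metis
  obtain S where S: "S \<subseteq> A" "finite S" "A \<subseteq> (\<Union>x\<in>S. cube x (\<rho> x))"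
    "\<forall>x\<in>S. \<forall>y\<in>S. x \<noteq> y \<longrightarrow> y \<notin> cube x (max (\<rho> x) (\<rho> y))"
    using besicovitch_selection[OF R \<open>bounded A\<close>, of \<rho>] \<rho> by blast
  have cube [measurable]: "cube x l \<in> sets \<nu>" for x l
    using open_in_sets[OF \<nu>] by simp
  have "emeasure \<nu> A \<le> emeasure \<nu> (\<Union>x\<in>S. cube x (\<rho> x))"
    using S(2,3) by (intro emeasure_mono sets.finite_UN cube) auto
  also have "\<dots> \<le> (\<Sum>x\<in>S. emeasure \<nu> (cube x (\<rho> x)))"
    using S(2) by (intro emeasure_subadditive_finite) auto
  finally have "c * emeasure \<nu> A \<le> (\<Sum>x\<in>S. c * emeasure \<nu> (cube x (\<rho> x)))"
    unfolding sum_distrib_left[symmetric] by (rule mult_left_mono) simp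
  also have "\<dots> \<le> (\<Sum>x\<in>S. \<integral>\<^sup>+y\<in>cube x (\<rho> x). K y \<partial>\<nu>)"
    using S(1) \<rho> by (intro sum_mono) auto
  also have "\<dots> = (\<integral>\<^sup>+y. K y * of_nat (card {x \<in> S. y \<in> cube x (\<rho> x)}) \<partial>\<nu>)"
  proof (subst nn_integral_sum[symmetric])
    have "(\<Sum>x\<in>S. K y * indicator (cube x (\<rho> x)) y) = K y * of_nat (card {x \<in> S. y \<in> cube x (\<rho> x)})" for y
      using S(2) by (simp add: sum_distrib_left[symmetric] indicator_def sum.If_cases Int_def)
    then show "(\<integral>\<^sup>+y. (\<Sum>x\<in>S. K y * indicator (cube x (\<rho> x)) y) \<partial>\<nu>) = (\<integral>\<^sup>+y. K y * of_nat (card {x \<in> S. y \<in> cube x (\<rho> x)}) \<partial>\<nu>)"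
      by simp
  qed (use K in measurable)
  also have "\<dots> \<le> (\<integral>\<^sup>+y. 2 ^ CARD('n) * K y \<partial>\<nu>)"
  proof (rule nn_integral_mono)
    fix y
    have "of_nat (card {x \<in> S. y \<in> cube x (\<rho> x)}) \<le> (of_nat (2 ^ CARD('n)) :: ennreal)"
      using separated_cubes_overlap[OF S(4)] by (rule of_nat_mono)
    then show "K y * of_nat (card {x \<in> S. y \<in> cube x (\<rho> x)}) \<le> 2 ^ CARD('n) * K y"
      by (subst mult.commute, intro mult_right_mono) auto
  qed
  also have "\<dots> = 2 ^ CARD('n) * (\<integral>\<^sup>+y. K y \<partial>\<nu>)"
    using K by (rule nn_integral_cmult)
  finally show ?thesis .
qed

text \<open>
  The relation \<open>y \<in> cube x l\<close> is open in \<open>(x, y)\<close>, so Tonelli's theorem applies.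
\<close>
lemma measurable_cube_integral:
  fixes \<nu> :: "(real ^ 'n) measure"
  assumes "finite_measure \<nu>" and \<nu>: "sets borel \<subseteq> sets \<nu>" and K [measurable]: "K \<in> borel_measurable \<nu>"
  shows "(\<lambda>x. \<integral>\<^sup>+y\<in>cube x l. K y \<partial>\<nu>) \<in> borel_measurable borel"
proof -
  interpret finite_measure \<nu> by fact
  have [measurable]: "snd \<in> borel_measurable (borel \<Otimes>\<^sub>M \<nu>)"
    using measurable_comp[OF measurable_snd ident_to_borel[OF \<nu>]] by (simp add: comp_def)
  have pair: "(\<lambda>p :: (real ^ 'n) \<times> (real ^ 'n). (fst p, snd p)) \<in> borel_measurable (borel \<Otimes>\<^sub>M \<nu>)"
    by (rule borel_measurable_Pair) measurable
  have "open (\<Inter>i. {p :: (real ^ 'n) \<times> (real ^ 'n). \<bar>snd p $ i - fst p $ i\<bar> < l / 2})"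
    by (intro open_INT ballI open_Collect_less continuous_intros) auto
  moreover have "{p :: (real ^ 'n) \<times> (real ^ 'n). snd p \<in> cube (fst p) l} =
      (\<Inter>i. {p. \<bar>snd p $ i - fst p $ i\<bar> < l / 2})"
    by (auto simp only: mem_cube)
  ultimately have "{p :: (real ^ 'n) \<times> (real ^ 'n). snd p \<in> cube (fst p) l} \<in> sets borel"
    by simp
  from measurable_sets[OF pair this] have "{p :: (real ^ 'n) \<times> (real ^ 'n). snd p \<in> cube (fst p) l} \<in> sets (borel \<Otimes>\<^sub>M \<nu>)"
    by (simp add: space_pair_measure space_of_borel_subset[OF \<nu>] vimage_def)
  then have "indicator {p :: (real ^ 'n) \<times> (real ^ 'n). snd p \<in> cube (fst p) l} \<in> (borel_measurable (borel \<Otimes>\<^sub>M \<nu>) :: (_ \<Rightarrow> ennreal) set)"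
    by (rule borel_measurable_indicator)
  then have "(\<lambda>p. K (snd p) * indicator {p. snd p \<in> cube (fst p) l} p) \<in> borel_measurable (borel \<Otimes>\<^sub>M \<nu>)"
    using measurable_comp[OF measurable_snd K] by (intro borel_measurable_times_ennreal) (simp add: comp_def)
  then have "(\<lambda>(x, y). K y * indicator (cube x l) y) \<in> borel_measurable (borel \<Otimes>\<^sub>M \<nu>)"
    by (simp add: case_prod_beta indicator_def)
  then show ?thesis by (rule borel_measurable_nn_integral)
qed

lemma measurable_cube_emeasure:
  fixes \<nu> :: "(real ^ 'n) measure"
  assumes "finite_measure \<nu>" and \<nu>: "sets borel \<subseteq> sets \<nu>"
  shows "(\<lambda>x. emeasure \<nu> (cube x l)) \<in> borel_measurable borel"
proof -
  have "(\<integral>\<^sup>+y\<in>cube x l. 1 \<partial>\<nu>) = emeasure \<nu> (cube x l)" for x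
    using open_in_sets[OF \<nu> open_cube] by (subst nn_integral_cmult_indicator) auto
  then show ?thesis using measurable_cube_integral[OF assms, of "\<lambda>_. 1" l] by simp
qed

definition centred_maximal :: "(real ^ 'n) measure \<Rightarrow> (real ^ 'n \<Rightarrow> ennreal) \<Rightarrow> real ^ 'n \<Rightarrow> ennreal" where
  "centred_maximal \<nu> K x = (SUP l\<in>{0<..}. (\<integral>\<^sup>+y\<in>cube x l. K y \<partial>\<nu>) / emeasure \<nu> (cube x l))"

lemma less_cube_average_iff:
  fixes \<nu> :: "(real ^ 'n) measure"
  assumes "finite_measure \<nu>" and \<nu>: "sets borel \<subseteq> sets \<nu>" and K: "K \<in> borel_measurable \<nu>"
  shows "c < (\<integral>\<^sup>+y\<in>cube x l. K y \<partial>\<nu>) / emeasure \<nu> (cube x l) \<longleftrightarrow>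
    c * emeasure \<nu> (cube x l) < (\<integral>\<^sup>+y\<in>cube x l. K y \<partial>\<nu>)" (is "c < ?I / ?m \<longleftrightarrow> _")
proof -
  interpret finite_measure \<nu> by fact
  show ?thesis
  proof (cases "?m = 0")
    case True
    then have "cube x l \<in> null_sets \<nu>" using open_in_sets[OF \<nu>] by (intro null_setsI) auto
    then have "?I = 0" by (intro nn_integral_null_set)
    then show ?thesis using True by simp
  next
    case False
    have "?I / ?m \<le> c \<longleftrightarrow> ?I \<le> c * ?m"
    proof
      assume "?I / ?m \<le> c"
      then have "?I / ?m * ?m \<le> c * ?m" by (rule mult_right_mono) simp
      moreover have "?m / ?m = 1" using False by (simp add: ennreal_divide_self less_top[symmetric])
      ultimately show "?I \<le> c * ?m" by (simp add: ennreal_divide_times)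
    next
      assume "?I \<le> c * ?m"
      then show "?I / ?m \<le> c" using False by (intro divide_le_posI_ennreal) (auto simp: zero_less_iff_neq_zero mult.commute)
    qed
    then show ?thesis by (simp add: linorder_not_le[symmetric])
  qed
qed

text \<open>
  Rational sides suffice: cubes are open, so the integral over a cube is the limit of integrals over
  slightly smaller ones, whose measure is no larger. The maximal function is thereby a countable
  supremum, hence measurable and accessible from finitely many radii.
\<close>
lemma less_centred_maximal_iff:
  fixes \<nu> :: "(real ^ 'n) measure"
  assumes fin: "finite_measure \<nu>" and \<nu>: "sets borel \<subseteq> sets \<nu>" and K: "K \<in> borel_measurable \<nu>"
  shows "c < centred_maximal \<nu> K x \<longleftrightarrow>
    (\<exists>l\<in>\<rat> \<inter> {0<..}. c * emeasure \<nu> (cube x l) < (\<integral>\<^sup>+y\<in>cube x l. K y \<partial>\<nu>))"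
proof -
  have cube: "cube x l \<in> sets \<nu>" for l using open_in_sets[OF \<nu>] by simp
  have "\<exists>l\<in>\<rat> \<inter> {0<..}. c * emeasure \<nu> (cube x l) < (\<integral>\<^sup>+y\<in>cube x l. K y \<partial>\<nu>)"
    if l: "0 < l" "c * emeasure \<nu> (cube x l) < (\<integral>\<^sup>+y\<in>cube x l. K y \<partial>\<nu>)" for l
  proof -
    define \<rho> where "\<rho> k = l - l / real (k + 2)" for k
    have \<rho>: "\<rho> k < l" "0 < \<rho> k" for k using l(1) by (auto simp: \<rho>_def field_simps add_pos_nonneg)
    have inc: "incseq \<rho>" unfolding incseq_def \<rho>_def using l(1) by (auto intro!: divide_left_mono)
    have "\<rho> \<longlonglongrightarrow> l - l * 0"
      unfolding \<rho>_def divide_inverse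
      by (intro tendsto_intros LIMSEQ_ignore_initial_segment[OF lim_inverse_n])
    then have lim: "\<rho> \<longlonglongrightarrow> l" by simp
    have "(\<integral>\<^sup>+y\<in>cube x l. K y \<partial>\<nu>) = emeasure (density \<nu> K) (cube x l)"
      using cube K by (simp add: emeasure_density)
    also have "\<dots> = (SUP k. emeasure (density \<nu> K) (cube x (\<rho> k)))"
      unfolding cube_increasing_limit[OF inc \<rho>(1) lim, of x]
      using cube inc by (intro SUP_emeasure_incseq[symmetric])
        (auto simp: incseq_def intro: cube_mono[THEN subsetD])
    finally obtain k where k: "c * emeasure \<nu> (cube x l) < emeasure (density \<nu> K) (cube x (\<rho> k))"
      using l(2) by (auto simp: less_SUP_iff)
    obtain u where u: "u \<in> \<rat>" "\<rho> k < u" "u < l" using Rats_dense_in_real[OF \<rho>(1)] by blast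
    have "c * emeasure \<nu> (cube x u) \<le> c * emeasure \<nu> (cube x l)"
      using u(3) cube by (intro mult_left_mono emeasure_mono cube_mono) auto
    also note k
    also have "emeasure (density \<nu> K) (cube x (\<rho> k)) \<le> emeasure (density \<nu> K) (cube x u)"
      using u(2) cube by (intro emeasure_mono cube_mono) auto
    also have "\<dots> = (\<integral>\<^sup>+y\<in>cube x u. K y \<partial>\<nu>)"
      using cube K by (simp add: emeasure_density)
    finally show ?thesis using u(1,2) \<rho>(2)[of k] by auto
  qed
  then show ?thesis
    unfolding centred_maximal_def less_SUP_iff less_cube_average_iff[OF assms] by auto
qed

lemma measurable_centred_maximal:
  fixes \<nu> :: "(real ^ 'n) measure"
  assumes fin: "finite_measure \<nu>" and \<nu>: "sets borel \<subseteq> sets \<nu>" and K: "K \<in> borel_measurable \<nu>"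
  shows "centred_maximal \<nu> K \<in> borel_measurable \<nu>"
proof (rule borel_measurableI_greater)
  fix c
  have "{x. c * emeasure \<nu> (cube x l) < (\<integral>\<^sup>+y\<in>cube x l. K y \<partial>\<nu>)} \<in> sets borel" for l
    using measurable_cube_integral[OF fin \<nu> K, of l] measurable_cube_emeasure[OF fin \<nu>, of l]
    by measurable
  then have "(\<Union>l\<in>\<rat> \<inter> {0<..}. {x. c * emeasure \<nu> (cube x l) < (\<integral>\<^sup>+y\<in>cube x l. K y \<partial>\<nu>)}) \<in> sets borel"
    using countable_rat by (intro sets.countable_UN') auto
  moreover have "{x \<in> space \<nu>. c < centred_maximal \<nu> K x} =
      (\<Union>l\<in>\<rat> \<inter> {0<..}. {x. c * emeasure \<nu> (cube x l) < (\<integral>\<^sup>+y\<in>cube x l. K y \<partial>\<nu>)})"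
    unfolding less_centred_maximal_iff[OF fin \<nu> K] space_of_borel_subset[OF \<nu>] by auto
  ultimately show "{x \<in> space \<nu>. c < centred_maximal \<nu> K x} \<in> sets \<nu>" using \<nu> by auto
qed

lemma weak_type:
  fixes \<nu> :: "(real ^ 'n) measure"
  assumes fin: "finite_measure \<nu>" and \<nu>: "sets borel \<subseteq> sets \<nu>" and K [measurable]: "K \<in> borel_measurable \<nu>"
    and A: "bounded A" "A \<in> sets \<nu>"
  shows "{x \<in> A. c < centred_maximal \<nu> K x} \<in> sets \<nu>"
    and "c * emeasure \<nu> {x \<in> A. c < centred_maximal \<nu> K x} \<le> 2 ^ CARD('n) * (\<integral>\<^sup>+y. K y \<partial>\<nu>)"
proof -
  define T where "T l = {x. c * emeasure \<nu> (cube x l) < (\<integral>\<^sup>+y\<in>cube x l. K y \<partial>\<nu>)}" for l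
  define e :: "nat \<Rightarrow> real" where "e = from_nat_into (\<rat> \<inter> {0<..})"
  define B where "B k = A \<inter> (\<Union>j<k. T (e j))" for k
  have "(1::real) \<in> \<rat> \<inter> {0<..}" by simp
  then have "\<rat> \<inter> {0<..} \<noteq> ({}::real set)" by blast
  moreover have "countable (\<rat> \<inter> {0<..} :: real set)" using countable_rat by (rule countable_subset[rotated]) auto
  ultimately have e: "range e = \<rat> \<inter> {0<..}" unfolding e_def by (rule range_from_nat_into)
  have "T l \<in> sets borel" for l
    using measurable_cube_integral[OF fin \<nu> K, of l] measurable_cube_emeasure[OF fin \<nu>, of l]
    unfolding T_def by measurable
  then have B: "B k \<in> sets \<nu>" for k
    unfolding B_def using A(2) \<nu> by (intro sets.Int sets.finite_UN) auto
  have eq: "{x \<in> A. c < centred_maximal \<nu> K x} = (\<Union>k. B k)"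
  proof -
    have "{x \<in> A. c < centred_maximal \<nu> K x} = A \<inter> (\<Union>l\<in>range e. T l)"
      unfolding e T_def using less_centred_maximal_iff[OF fin \<nu> K] by auto
    also have "\<dots> = (\<Union>k. B k)" unfolding B_def by auto
    finally show ?thesis .
  qed
  show "{x \<in> A. c < centred_maximal \<nu> K x} \<in> sets \<nu>" unfolding eq using B by blast
  have "incseq B" unfolding B_def incseq_def by (auto intro: less_le_trans)
  then have "emeasure \<nu> (\<Union>k. B k) = (SUP k. emeasure \<nu> (B k))"
    using B by (intro SUP_emeasure_incseq[symmetric]) auto
  moreover have "c * emeasure \<nu> (B k) \<le> 2 ^ CARD('n) * (\<integral>\<^sup>+y. K y \<partial>\<nu>)" for k
  proof (rule weak_type_finite_radii[OF \<nu> K, where R = "e ` {..<k}"])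
    show "\<And>b. b \<in> e ` {..<k} \<Longrightarrow> 0 < b" using e by blast
    show "bounded (B k)" using A(1) unfolding B_def by (rule bounded_subset) auto
    show "\<exists>b\<in>e ` {..<k}. c * emeasure \<nu> (cube x b) \<le> (\<integral>\<^sup>+y\<in>cube x b. K y \<partial>\<nu>)" if "x \<in> B k" for x
      using that unfolding B_def T_def by (auto intro: less_imp_le)
  qed simp
  ultimately show "c * emeasure \<nu> {x \<in> A. c < centred_maximal \<nu> K x} \<le> 2 ^ CARD('n) * (\<integral>\<^sup>+y. K y \<partial>\<nu>)"
    unfolding eq by (simp add: SUP_mult_left_ennreal SUP_least)
qed

text \<open>
  Values of \<open>K\<close> up to \<open>c\<close> contribute at most \<open>c\<close> to any average, so an average above \<open>2 * c\<close> forces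
  one above \<open>c\<close> for the truncation of \<open>K\<close> at height \<open>c\<close>.
\<close>
lemma weak_type_truncated:
  fixes \<nu> :: "(real ^ 'n) measure"
  assumes fin: "finite_measure \<nu>" and \<nu>: "sets borel \<subseteq> sets \<nu>" and K [measurable]: "K \<in> borel_measurable \<nu>"
    and A: "bounded A" "A \<in> sets \<nu>" and "c < \<infinity>"
  shows "c * emeasure \<nu> {x \<in> A. 2 * c < centred_maximal \<nu> K x}
    \<le> 2 ^ CARD('n) * (\<integral>\<^sup>+y. K y * indicator {y. c < K y} y \<partial>\<nu>)"
proof -
  interpret finite_measure \<nu> by fact
  define H where "H y = K y * indicator {y. c < K y} y" for y
  have sp: "space \<nu> = UNIV" using space_of_borel_subset[OF \<nu>] .
  have "{y \<in> space \<nu>. c < K y} \<in> sets \<nu>" by measurable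
  then have [measurable]: "{y. c < K y} \<in> sets \<nu>" using sp by simp
  have H [measurable]: "H \<in> borel_measurable \<nu>" unfolding H_def by measurable
  have "c < centred_maximal \<nu> H x" if x: "2 * c < centred_maximal \<nu> K x" for x
  proof -
    obtain l where l: "l \<in> \<rat> \<inter> {0<..}" "2 * c * emeasure \<nu> (cube x l) < (\<integral>\<^sup>+y\<in>cube x l. K y \<partial>\<nu>)"
      using x unfolding less_centred_maximal_iff[OF fin \<nu> K] by auto
    have cube [measurable]: "cube x l \<in> sets \<nu>" using open_in_sets[OF \<nu>] by simp
    have l2: "c * emeasure \<nu> (cube x l) + c * emeasure \<nu> (cube x l) < (\<integral>\<^sup>+y\<in>cube x l. K y \<partial>\<nu>)"
      using l(2) by (simp only: mult_2 distrib_right)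
    have "(\<integral>\<^sup>+y\<in>cube x l. K y \<partial>\<nu>) \<le> (\<integral>\<^sup>+y. H y * indicator (cube x l) y + c * indicator (cube x l) y \<partial>\<nu>)"
      by (intro nn_integral_mono) (auto simp: H_def indicator_def)
    also have "\<dots> = (\<integral>\<^sup>+y\<in>cube x l. H y \<partial>\<nu>) + c * emeasure \<nu> (cube x l)"
      using cube by (simp add: nn_integral_add nn_integral_cmult_indicator)
    finally have "c * emeasure \<nu> (cube x l) + c * emeasure \<nu> (cube x l) < c * emeasure \<nu> (cube x l) + (\<integral>\<^sup>+y\<in>cube x l. H y \<partial>\<nu>)"
      using l2 by (subst (2) add.commute) (rule less_le_trans)
    then have "c * emeasure \<nu> (cube x l) < (\<integral>\<^sup>+y\<in>cube x l. H y \<partial>\<nu>)"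
      by (metis add_left_mono linorder_not_le)
    then show ?thesis using l(1) unfolding less_centred_maximal_iff[OF fin \<nu> H] by auto
  qed
  then have "c * emeasure \<nu> {x \<in> A. 2 * c < centred_maximal \<nu> K x} \<le> c * emeasure \<nu> {x \<in> A. c < centred_maximal \<nu> H x}"
    using weak_type(1)[OF fin \<nu> H A] by (intro mult_left_mono emeasure_mono) auto
  also have "\<dots> \<le> 2 ^ CARD('n) * (\<integral>\<^sup>+y. H y \<partial>\<nu>)" by (rule weak_type(2)[OF fin \<nu> H A])
  finally show ?thesis unfolding H_def .
qed

section \<open>The strong type bound\<close>

text \<open>
  The sum is geometric with ratio greater than \<open>1\<close> and stops at the last \<open>k\<close> with \<open>2 ^ k < x\<close>, so it is
  comparable to its largest term, which is at most \<open>x powr (t - 1)\<close>.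
\<close>
lemma dyadic_geometric_sum:
  fixes t x :: real
  assumes "1 < t" "0 \<le> x"
  shows "(\<Sum>k<n. if 2 ^ k < x then (2 powr (t - 1)) ^ k else 0) \<le> 2 powr (t - 1) / (2 powr (t - 1) - 1) * x powr (t - 1)"
proof (induction n)
  case 0
  have "1 < 2 powr (t - 1)" using assms(1) by (intro gr_one_powr) auto
  then show ?case by simp
next
  case (Suc n)
  define b :: real where "b = 2 powr (t - 1)"
  have b: "1 < b" unfolding b_def using assms(1) by (intro gr_one_powr) auto
  show ?case
  proof (cases "2 ^ n < x")
    case True
    have "b ^ n = (2 ^ n) powr (t - 1)"
    proof -
      have "b ^ n = 2 powr (real n * (t - 1))" unfolding b_def by (simp add: powr_power mult.commute)
      moreover have "(2::real) ^ n = 2 powr real n" by (simp add: powr_realpow)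
      ultimately show ?thesis by (simp add: powr_powr)
    qed
    also have "\<dots> \<le> x powr (t - 1)" using True assms(1) by (intro powr_mono2) auto
    finally have bn: "b ^ n \<le> x powr (t - 1)" .
    have "(\<Sum>k<Suc n. if 2 ^ k < x then b ^ k else 0) \<le> (\<Sum>k<Suc n. b ^ k)"
      using b by (intro sum_mono) auto
    also have "\<dots> = (b ^ Suc n - 1) / (b - 1)" using b by (subst geometric_sum) auto
    also have "\<dots> \<le> b / (b - 1) * b ^ n" using b by (simp add: divide_right_mono)
    also have "\<dots> \<le> b / (b - 1) * x powr (t - 1)" using b bn by (intro mult_left_mono) auto
    finally show ?thesis unfolding b_def .
  next
    case False
    then show ?thesis using Suc.IH by simp
  qed
qed

lemma epowr_ennreal [simp]: "0 \<le> x \<Longrightarrow> epowr (ennreal x) a = ennreal (x powr a)"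
  by (simp add: epowr_def)

lemma epowr_top [simp]: "epowr top a = top"
  by (simp add: epowr_def)

lemma epowr_mono:
  assumes "x \<le> y" "0 \<le> a"
  shows "epowr x a \<le> epowr y a"
proof (cases y)
  case (real r)
  then obtain u where "x = ennreal u" "0 \<le> u" using assms(1) by (cases x) (auto simp: top_unique)
  then show ?thesis using real assms by (auto intro!: ennreal_leI powr_mono2)
qed simp

text \<open>
  A discrete layer cake formula: for finite \<open>T > 1\<close> the term with \<open>2 ^ k < T \<le> 2 ^ (k + 1)\<close> alone
  dominates, and for infinite \<open>T\<close> every term counts.
\<close>
lemma epowr_le_dyadic_sum:
  assumes "0 < t"
  shows "epowr T t \<le> 1 + (\<Sum>k. ennreal ((2 ^ (k + 1)) powr t) * indicator {x. 2 ^ k < x} T)"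
    (is "_ \<le> 1 + suminf ?f")
proof (cases "T \<le> 1")
  case True
  then have "epowr T t \<le> epowr (ennreal 1) t" using assms by (intro epowr_mono) auto
  also have "\<dots> = 1" by (subst epowr_ennreal) auto
  finally show ?thesis by (simp add: add_increasing2)
next
  case False
  have term_le: "?f k \<le> suminf ?f" for k
  proof -
    have "?f k = sum ?f {k}" by (subst sum.insert) (auto simp del: sum_mult_indicator)
    also have "\<dots> \<le> suminf ?f" by (rule sum_le_suminf) auto
    finally show ?thesis .
  qed
  show ?thesis
  proof (cases T)
    case (real x)
    then have x: "1 < x" using False by (simp add: ennreal_le_1[symmetric] not_le del: ennreal_le_1) 
    define k where "k = (LEAST k. x \<le> 2 ^ k)"
    obtain m where "x \<le> 2 ^ m" using real_arch_pow[of 2 x] by (auto intro: less_imp_le)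
    then have k: "x \<le> 2 ^ k" unfolding k_def by (rule LeastI)
    then obtain j where j: "k = Suc j" using x by (cases k) auto
    have "\<not> x \<le> 2 ^ j" using not_less_Least[of j "\<lambda>k. x \<le> 2 ^ k"] j unfolding k_def by simp
    then have "2 ^ j < T" unfolding real(2)
      by (metis ennreal_less_iff ennreal_numeral ennreal_power linorder_not_le zero_le_numeral zero_le_power)
    have "epowr T t = ennreal (x powr t)" using real by simp
    also have "\<dots> \<le> ennreal ((2 ^ (j + 1)) powr t)"
      using k j x assms by (intro ennreal_leI powr_mono2) auto
    also have "\<dots> = ?f j" using \<open>2 ^ j < T\<close> by simp
    also have "\<dots> \<le> 1 + suminf ?f" using term_le by (simp add: add_increasing)
    finally show ?thesis .
  next
    case top
    have "of_nat n \<le> suminf ?f" for n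
    proof -
      have "(1::real) \<le> (2 ^ (k + 1)) powr t" for k
        using assms one_le_power[of "2::real" "k + 1"] by (intro ge_one_powr_ge_zero) auto
      then have "1 \<le> ?f k" for k using top by (simp add: power_less_top_ennreal)
      then have "of_nat n \<le> (\<Sum>k<n. ?f k)" using sum_mono[of "{..<n}" "\<lambda>_. 1" ?f] by simp
      also have "\<dots> \<le> suminf ?f" by (rule sum_le_suminf) auto
      finally show ?thesis .
    qed
    then have "\<not> suminf ?f < top" using ennreal_Ex_less_of_nat by (metis linorder_not_le)
    then have "suminf ?f = top" using top.not_eq_extremum by blast
    then show ?thesis by simp
  qed
qed


text \<open>
  Marcinkiewicz interpolation in dyadic form: sum the truncated weak type bounds at the heights
  \<open>2 ^ k / 2\<close> against the layer cake sum and exchange sum and integral. Working with heights at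
  least \<open>1 / 2\<close> only costs the term \<open>emeasure \<nu> A\<close>, which is harmless for finite measures.
\<close>
lemma strong_type:
  fixes \<nu> :: "(real ^ 'n) measure"
  assumes fin: "finite_measure \<nu>" and \<nu>: "sets borel \<subseteq> sets \<nu>"
    and A: "bounded A" "A \<in> sets \<nu>" and "1 < t"
  shows "\<exists>C\<ge>0. \<forall>K\<in>borel_measurable \<nu>. (\<forall>y. 0 \<le> K y) \<longrightarrow>
    (\<integral>\<^sup>+x\<in>A. epowr (centred_maximal \<nu> (\<lambda>y. ennreal (K y)) x) t \<partial>\<nu>)
      \<le> emeasure \<nu> A + ennreal C * (\<integral>\<^sup>+y. ennreal (K y powr t) \<partial>\<nu>)"
proof -
  define b :: real where "b = 2 powr (t - 1)"
  have b: "1 < b" unfolding b_def using \<open>1 < t\<close> by (intro gr_one_powr) auto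
  define D :: real where "D = 2 powr (t + 1) * 2 ^ CARD('n)"
  have D: "0 \<le> D" unfolding D_def by simp
  define C where "C = D * (b / (b - 1)) * 2 powr (t - 1)"
  have C: "0 \<le> C" unfolding C_def using b D by simp
  have "(\<integral>\<^sup>+x\<in>A. epowr (centred_maximal \<nu> (\<lambda>y. ennreal (K y)) x) t \<partial>\<nu>)
      \<le> emeasure \<nu> A + ennreal C * (\<integral>\<^sup>+y. ennreal (K y powr t) \<partial>\<nu>)"
    if K [measurable]: "K \<in> borel_measurable \<nu>" and K0: "\<And>y. 0 \<le> K y" for K
  proof -
    have K' [measurable]: "(\<lambda>y. ennreal (K y)) \<in> borel_measurable \<nu>" by measurable
    define T where "T = centred_maximal \<nu> (\<lambda>y. ennreal (K y))"
    define M where "M k = {x \<in> A. 2 ^ k < T x}" for k :: nat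
    define c where "c k = ((2 ^ (k + 1)) powr t :: real)" for k :: nat
    define S where "S k y = (if 2 ^ k < 2 * K y then b ^ k else 0)" for k :: nat and y
    have [measurable]: "A \<in> sets \<nu>" by fact
    have M [measurable]: "M k \<in> sets \<nu>" for k
      unfolding M_def T_def by (rule weak_type(1)[OF fin \<nu> K' A])
    have S0: "0 \<le> S k y" for k y using b by (simp add: S_def)
    have [measurable]: "S k \<in> borel_measurable \<nu>" for k unfolding S_def by measurable
    have step: "ennreal (c k) * emeasure \<nu> (M k) \<le> (\<integral>\<^sup>+y. ennreal (D * K y * S k y) \<partial>\<nu>)" for k
    proof -
      have ck: "c k = 2 powr (t + 1) * b ^ k * (2 ^ k / 2)"
      proof -
        have "b ^ k = 2 powr (real k * (t - 1))" unfolding b_def by (simp add: powr_power mult.commute)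
        moreover have "(2::real) ^ k = 2 powr real k" by (simp add: powr_realpow)
        moreover have "c k = 2 powr ((real k + 1) * t)"
          unfolding c_def by (simp add: powr_realpow[symmetric] powr_powr add.commute del: power_Suc)
        moreover have "(2::real) powr (t + 1) = 2 powr t * 2" by (simp add: powr_add)
        ultimately show ?thesis by (simp add: powr_add[symmetric] algebra_simps)
      qed
      have two: "2 * ennreal (2 ^ k / 2) = 2 ^ k"
        by (simp add: ennreal_mult'[symmetric] ennreal_power[symmetric] flip: ennreal_numeral)
      have "ennreal (2 ^ k / 2) * emeasure \<nu> (M k)
          \<le> 2 ^ CARD('n) * (\<integral>\<^sup>+y. ennreal (K y) * indicator {y. ennreal (2 ^ k / 2) < ennreal (K y)} y \<partial>\<nu>)"
        using weak_type_truncated[OF fin \<nu> K' A, of "ennreal (2 ^ k / 2)"] unfolding M_def T_def two by simp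
      then have "ennreal (2 powr (t + 1) * b ^ k) * (ennreal (2 ^ k / 2) * emeasure \<nu> (M k))
          \<le> ennreal (2 powr (t + 1) * b ^ k) * (2 ^ CARD('n) * (\<integral>\<^sup>+y. ennreal (K y) * indicator {y. ennreal (2 ^ k / 2) < ennreal (K y)} y \<partial>\<nu>))"
        by (rule mult_left_mono) simp
      also have "ennreal (2 powr (t + 1) * b ^ k) * (ennreal (2 ^ k / 2) * emeasure \<nu> (M k)) = ennreal (c k) * emeasure \<nu> (M k)"
        unfolding ck using b by (subst mult.assoc[symmetric], subst ennreal_mult[symmetric]) auto
      also have "ennreal (2 powr (t + 1) * b ^ k) * (2 ^ CARD('n) * (\<integral>\<^sup>+y. ennreal (K y) * indicator {y. ennreal (2 ^ k / 2) < ennreal (K y)} y \<partial>\<nu>))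
          = ennreal (D * b ^ k) * (\<integral>\<^sup>+y. ennreal (K y) * indicator {y. ennreal (2 ^ k / 2) < ennreal (K y)} y \<partial>\<nu>)"
      proof -
        have "(2::ennreal) ^ CARD('n) = ennreal (2 ^ CARD('n))" by (simp add: ennreal_power[symmetric])
        then show ?thesis unfolding D_def using b
          by (simp add: mult.assoc[symmetric] ennreal_mult'[symmetric] ennreal_mult''[symmetric]) (simp add: mult_ac)
      qed
      also have "\<dots> = (\<integral>\<^sup>+y. ennreal (D * b ^ k) * (ennreal (K y) * indicator {y. 2 ^ k < 2 * K y} y) \<partial>\<nu>)"
      proof -
        have "{y. ennreal (2 ^ k / 2) < ennreal (K y)} = {y. 2 ^ k < 2 * K y}"
          using K0 by (auto simp: ennreal_less_iff)
        moreover have "{y \<in> space \<nu>. 2 ^ k < 2 * K y} \<in> sets \<nu>" by measurable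
        ultimately show ?thesis using space_of_borel_subset[OF \<nu>]
          by (subst nn_integral_cmult) auto
      qed
      also have "\<dots> = (\<integral>\<^sup>+y. ennreal (D * K y * S k y) \<partial>\<nu>)"
        using K0 b D by (intro nn_integral_cong) (auto simp: S_def indicator_def ennreal_mult[symmetric] mult_ac)
      finally show ?thesis .
    qed
    have "(\<integral>\<^sup>+x\<in>A. epowr (T x) t \<partial>\<nu>) \<le> (\<integral>\<^sup>+x. indicator A x + (\<Sum>k. ennreal (c k) * indicator (M k) x) \<partial>\<nu>)"
    proof (rule nn_integral_mono)
      fix x
      have "epowr (T x) t \<le> 1 + (\<Sum>k. ennreal (c k) * indicator {x. 2 ^ k < x} (T x))"
        unfolding c_def using epowr_le_dyadic_sum[of t "T x"] \<open>1 < t\<close> by simp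
      then show "epowr (T x) t * indicator A x \<le> indicator A x + (\<Sum>k. ennreal (c k) * indicator (M k) x)"
        unfolding M_def by (cases "x \<in> A") (auto simp: indicator_def)
    qed
    also have "\<dots> = emeasure \<nu> A + (\<Sum>k. ennreal (c k) * emeasure \<nu> (M k))"
      by (subst nn_integral_add) (auto simp: nn_integral_suminf nn_integral_cmult_indicator)
    also have "\<dots> \<le> emeasure \<nu> A + (\<Sum>k. \<integral>\<^sup>+y. ennreal (D * K y * S k y) \<partial>\<nu>)"
      using step by (intro add_left_mono suminf_le) auto
    also have "\<dots> = emeasure \<nu> A + (\<integral>\<^sup>+y. (\<Sum>k. ennreal (D * K y * S k y)) \<partial>\<nu>)"
      by (subst nn_integral_suminf) auto
    also have "\<dots> \<le> emeasure \<nu> A + (\<integral>\<^sup>+y. ennreal C * ennreal (K y powr t) \<partial>\<nu>)"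
    proof (intro add_left_mono nn_integral_mono suminf_le_const summableI)
      fix y n
      have "(\<Sum>k<n. ennreal (D * K y * S k y)) = ennreal (D * K y * (\<Sum>k<n. S k y))"
        using D K0 S0 by (subst sum_ennreal) (auto simp: sum_distrib_left)
      also have "\<dots> \<le> ennreal (D * K y * (b / (b - 1) * (2 * K y) powr (t - 1)))"
        using dyadic_geometric_sum[OF \<open>1 < t\<close>, of "2 * K y" n] D K0
        unfolding S_def b_def by (intro ennreal_leI mult_left_mono) auto
      also have "D * K y * (b / (b - 1) * (2 * K y) powr (t - 1)) = C * K y powr t"
      proof (cases "K y = 0")
        case False
        then have "K y powr t = K y * K y powr (t - 1)" using K0[of y] by (simp add: powr_diff)
        then show ?thesis using K0[of y] unfolding C_def by (simp add: powr_mult)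
      qed simp
      finally show "(\<Sum>k<n. ennreal (D * K y * S k y)) \<le> ennreal C * ennreal (K y powr t)"
        using C by (simp add: ennreal_mult)
    qed
    also have "\<dots> = emeasure \<nu> A + ennreal C * (\<integral>\<^sup>+y. ennreal (K y powr t) \<partial>\<nu>)"
      by (subst nn_integral_cmult) auto
    finally show ?thesis unfolding T_def .
  qed
  then show ?thesis using C by blast
qed

section \<open>Hoelder's inequality\<close>

lemma weighted_am_gm:
  fixes u v a :: real
  assumes "0 \<le> u" "0 \<le> v" "0 \<le> a" "a \<le> 1"
  shows "u powr a * v powr (1 - a) \<le> a * u + (1 - a) * v"
proof (cases "u = 0 \<or> v = 0")
  case False
  then have "u powr a * v powr (1 - a) = exp (a * ln u + (1 - a) * ln v)"
    by (simp add: powr_def exp_add)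
  also have "\<dots> \<le> a * exp (ln u) + (1 - a) * exp (ln v)"
    using convex_onD[OF exp_convex, of "1 - a" "ln u" "ln v"] assms by simp
  finally show ?thesis using False assms by simp
qed (use assms in auto)

text \<open>
  The exponents are \<open>1 / a\<close> and \<open>1 / (1 - a)\<close>, with the norms replaced by real upper bounds, which keeps all
  powers within the reals.
\<close>
lemma nn_integral_Hoelder:
  assumes [measurable]: "f \<in> borel_measurable M" "g \<in> borel_measurable M"
    and fg: "\<And>x. 0 \<le> f x" "\<And>x. 0 \<le> g x" and a: "0 \<le> a" "a \<le> 1"
    and X: "(\<integral>\<^sup>+x. ennreal (f x) \<partial>M) \<le> ennreal X" "0 \<le> X"
    and Y: "(\<integral>\<^sup>+x. ennreal (g x) \<partial>M) \<le> ennreal Y" "0 \<le> Y"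
  shows "(\<integral>\<^sup>+x. ennreal (f x powr a * g x powr (1 - a)) \<partial>M) \<le> ennreal (X powr a * Y powr (1 - a))"
proof (cases "X = 0 \<or> Y = 0")
  case True
  then have "(\<integral>\<^sup>+x. ennreal (f x) \<partial>M) = 0 \<or> (\<integral>\<^sup>+x. ennreal (g x) \<partial>M) = 0" using X Y by auto
  then have "(AE x in M. f x = 0) \<or> (AE x in M. g x = 0)"
    using fg by (simp add: nn_integral_0_iff_AE ennreal_eq_0_iff order_antisym_conv)
  then have "AE x in M. ennreal (f x powr a * g x powr (1 - a)) = 0" by (elim disjE; auto)
  then have "(\<integral>\<^sup>+x. ennreal (f x powr a * g x powr (1 - a)) \<partial>M) = 0" by (subst nn_integral_0_iff_AE) auto
  then show ?thesis by simp
next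
  case False
  then have XY: "0 < X" "0 < Y" using X Y by auto
  define Z where "Z = X powr a * Y powr (1 - a)"
  have Z: "0 \<le> Z" unfolding Z_def by simp
  have "(\<integral>\<^sup>+x. ennreal (f x powr a * g x powr (1 - a)) \<partial>M)
      \<le> (\<integral>\<^sup>+x. ennreal (Z * a / X) * ennreal (f x) + ennreal (Z * (1 - a) / Y) * ennreal (g x) \<partial>M)"
  proof (rule nn_integral_mono)
    fix x
    have "f x powr a * g x powr (1 - a) = Z * ((f x / X) powr a * (g x / Y) powr (1 - a))"
      unfolding Z_def using fg[of x] XY by (simp add: powr_divide)
    also have "\<dots> \<le> Z * (a * (f x / X) + (1 - a) * (g x / Y))"
      using weighted_am_gm[of "f x / X" "g x / Y" a] a fg[of x] XY Z by (intro mult_left_mono) auto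
    also have "\<dots> = Z * a / X * f x + Z * (1 - a) / Y * g x" by (simp add: algebra_simps)
    finally show "ennreal (f x powr a * g x powr (1 - a)) \<le> ennreal (Z * a / X) * ennreal (f x) + ennreal (Z * (1 - a) / Y) * ennreal (g x)"
      using a fg[of x] XY Z by (simp add: ennreal_mult[symmetric] ennreal_plus[symmetric] ennreal_leI del: ennreal_plus)
  qed
  also have "\<dots> = ennreal (Z * a / X) * (\<integral>\<^sup>+x. ennreal (f x) \<partial>M) + ennreal (Z * (1 - a) / Y) * (\<integral>\<^sup>+x. ennreal (g x) \<partial>M)"
    by (subst nn_integral_add) (auto simp: nn_integral_cmult)
  also have "\<dots> \<le> ennreal (Z * a / X) * ennreal X + ennreal (Z * (1 - a) / Y) * ennreal Y"
    using X(1) Y(1) by (intro add_mono mult_left_mono) auto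
  also have "\<dots> = ennreal (Z * a / X * X + Z * (1 - a) / Y * Y)"
    using a XY Z by (simp add: ennreal_mult[symmetric] ennreal_plus[symmetric] del: ennreal_plus)
  also have "Z * a / X * X + Z * (1 - a) / Y * Y = Z" using XY by (simp add: ring_distribs diff_divide_distrib)
  finally show ?thesis unfolding Z_def .
qed

section \<open>Muckenhoupt weights\<close>

lemma AE_not_null_imp_ex:
  assumes "AE x in M. x \<in> S \<longrightarrow> P x" "S \<in> sets M" "emeasure M S \<noteq> 0"
  shows "\<exists>x\<in>S. P x"
proof (rule ccontr)
  assume "\<not> ?thesis"
  then have "AE x in M. x \<notin> S" using assms(1) by auto
  then have "S \<in> null_sets M" using assms(2) by (simp add: AE_iff_null_sets)
  then show False using assms(3) by auto
qed

lemma nn_integral_pos_on: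
  fixes F :: "'a \<Rightarrow> real"
  assumes [measurable]: "F \<in> borel_measurable M" "S \<in> sets M"
    and F: "\<And>x. 0 < F x" and S: "emeasure M S \<noteq> 0"
  shows "(\<integral>\<^sup>+x\<in>S. ennreal (F x) \<partial>M) \<noteq> 0"
proof
  assume "(\<integral>\<^sup>+x\<in>S. ennreal (F x) \<partial>M) = 0"
  then have "AE x in M. ennreal (F x) * indicator S x = 0" by (subst (asm) nn_integral_0_iff_AE) auto
  then have "AE x in M. x \<in> S \<longrightarrow> False"
  proof eventually_elim
    case (elim x)
    then show ?case using F[of x] by (auto simp: indicator_def)
  qed
  then show False using AE_not_null_imp_ex[of S "\<lambda>_. False"] S assms(2) by blast
qed

text \<open>
  With \<open>\<nu>\<close> the measure of density \<open>V\<close> and \<open>m\<close> the measure of the cube whose trace on \<open>\<Omega>\<close> is \<open>Q\<close>, this is the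
  form \<open>((1 / m) \<integral>\<^sub>Q h d\<mu>)\<^sup>\<sigma> \<le> (C / \<nu>(Q)) \<integral>\<^sub>Q h\<^sup>\<sigma> d\<nu>\<close> of the Muckenhoupt condition. It covers \<open>\<sigma> = 1\<close> and
  \<open>\<sigma> > 1\<close> alike. The denominators are cleared, so null sets cause no exception.
\<close>
definition average_bound ::
  "'a measure \<Rightarrow> ('a \<Rightarrow> real) \<Rightarrow> real \<Rightarrow> 'a set \<Rightarrow> real \<Rightarrow> real \<Rightarrow> bool" where
  "average_bound \<mu> V \<sigma> Q m C \<longleftrightarrow> (\<integral>\<^sup>+y\<in>Q. ennreal (V y) \<partial>\<mu>) < \<infinity> \<and>
    (\<forall>h\<in>borel_measurable \<mu>. \<forall>I\<ge>0. (\<forall>y. 0 \<le> h y) \<longrightarrow>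
      (\<integral>\<^sup>+y\<in>Q. ennreal (h y powr \<sigma> * V y) \<partial>\<mu>) \<le> ennreal I \<longrightarrow>
      (\<exists>Y\<ge>0. (\<integral>\<^sup>+y\<in>Q. ennreal (h y) \<partial>\<mu>) = ennreal Y \<and>
        Y powr \<sigma> * enn2real (\<integral>\<^sup>+y\<in>Q. ennreal (V y) \<partial>\<mu>) \<le> C * m powr \<sigma> * I))"

lemma average_bound_null:
  assumes "Q \<in> null_sets \<mu>" "0 \<le> C"
  shows "average_bound \<mu> V \<sigma> Q m C"
  using nn_integral_null_set[OF assms(1)] assms(2) unfolding average_bound_def
  by (auto intro!: exI[of _ 0])

text \<open>
  The \<open>A\<^sub>1\<close> condition is a pointwise bound \<open>N \<le> C * m * V\<close> with \<open>N = \<nu>(Q)\<close>; multiply it by \<open>h\<close> and integrate.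
\<close>
lemma average_bound_A1:
  assumes [measurable]: "V \<in> borel_measurable \<mu>" and Q [measurable]: "Q \<in> sets \<mu>"
    and V0: "\<And>y. 0 < V y" and Q0: "emeasure \<mu> Q \<noteq> 0" and m: "0 < m" and C: "0 < C"
    and A1: "AE x in \<mu>. x \<in> Q \<longrightarrow> (\<integral>\<^sup>+y\<in>Q. ennreal (V y) \<partial>\<mu>) / ennreal m \<le> ennreal (C * V x)"
  shows "average_bound \<mu> V 1 Q m C"
proof -
  define A where "A = (\<integral>\<^sup>+y\<in>Q. ennreal (V y) \<partial>\<mu>)"
  obtain x where "A / ennreal m \<le> ennreal (C * V x)"
    using AE_not_null_imp_ex[OF A1 Q Q0] unfolding A_def by blast
  then have "A / ennreal m \<noteq> top" by (auto simp: top_unique)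
  then have "A \<noteq> top" using m by (auto simp: ennreal_top_divide)
  moreover have "A \<noteq> 0" unfolding A_def by (rule nn_integral_pos_on) (use V0 Q0 in auto)
  ultimately obtain N where N: "A = ennreal N" "0 < N" by (cases A) (auto simp: less_le)
  have AE: "AE x in \<mu>. x \<in> Q \<longrightarrow> N \<le> C * m * V x"
    using A1
  proof eventually_elim
    case (elim x)
    have "ennreal (N / m) \<le> ennreal (C * V x) \<longleftrightarrow> N / m \<le> C * V x"
      using C V0[of x] by (intro ennreal_le_iff) simp
    then show ?case using elim m N unfolding A_def[symmetric] by (auto simp: divide_ennreal field_simps)
  qed
  have "\<exists>Y\<ge>0. (\<integral>\<^sup>+y\<in>Q. ennreal (h y) \<partial>\<mu>) = ennreal Y \<and> Y powr 1 * N \<le> C * m powr 1 * I"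
    if h [measurable]: "h \<in> borel_measurable \<mu>" and h0: "\<And>y. 0 \<le> h y" and I: "0 \<le> I"
      "(\<integral>\<^sup>+y\<in>Q. ennreal (h y powr 1 * V y) \<partial>\<mu>) \<le> ennreal I" for h I
  proof -
    have "ennreal N * (\<integral>\<^sup>+y\<in>Q. ennreal (h y) \<partial>\<mu>) = (\<integral>\<^sup>+y. ennreal N * (ennreal (h y) * indicator Q y) \<partial>\<mu>)"
      by (subst nn_integral_cmult) auto
    also have "\<dots> \<le> (\<integral>\<^sup>+y. ennreal (C * m) * (ennreal (h y powr 1 * V y) * indicator Q y) \<partial>\<mu>)"
    proof (rule nn_integral_mono_AE)
      show "AE y in \<mu>. ennreal N * (ennreal (h y) * indicator Q y) \<le> ennreal (C * m) * (ennreal (h y powr 1 * V y) * indicator Q y)"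
        using AE
      proof eventually_elim
        case (elim y)
        show ?case
        proof (cases "y \<in> Q")
          case True
          have "N * h y \<le> C * m * V y * h y" using elim True h0 by (intro mult_right_mono) auto
          then have "ennreal (N * h y) \<le> ennreal (C * m * (h y * V y))" by (intro ennreal_leI) (simp add: mult_ac)
          then show ?thesis using True h0[of y] N(2) C m V0[of y] by (simp add: ennreal_mult)
        qed simp
      qed
    qed
    also have "\<dots> = ennreal (C * m) * (\<integral>\<^sup>+y\<in>Q. ennreal (h y powr 1 * V y) \<partial>\<mu>)"
      by (subst nn_integral_cmult) auto
    also have "\<dots> \<le> ennreal (C * m) * ennreal I" using I(2) by (rule mult_left_mono) simp
    also have "\<dots> = ennreal (C * m * I)" using C m I by (simp add: ennreal_mult)
    finally have le: "ennreal N * (\<integral>\<^sup>+y\<in>Q. ennreal (h y) \<partial>\<mu>) \<le> ennreal (C * m * I)" .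
    then have "(\<integral>\<^sup>+y\<in>Q. ennreal (h y) \<partial>\<mu>) \<noteq> top" using N(2) by (auto simp: ennreal_mult_top top_unique)
    then obtain Y where Y: "0 \<le> Y" "(\<integral>\<^sup>+y\<in>Q. ennreal (h y) \<partial>\<mu>) = ennreal Y"
      by (cases "(\<integral>\<^sup>+y\<in>Q. ennreal (h y) \<partial>\<mu>)") auto
    have "ennreal (N * Y) \<le> ennreal (C * m * I)" using le N(2) Y by (simp add: ennreal_mult)
    then have "N * Y \<le> C * m * I" using C m I(1) by (subst (asm) ennreal_le_iff) auto
    then show ?thesis using Y m by (intro exI[of _ Y]) (auto simp: mult_ac)
  qed
  then show ?thesis using N unfolding average_bound_def A_def[symmetric] by auto
qed

text \<open>
  Hoelder's inequality for \<open>h = (h\<^sup>\<sigma> V)\<^sup>1\<^sup>/\<^sup>\<sigma> \<cdot> V\<^sup>-\<^sup>1\<^sup>/\<^sup>\<sigma>\<close>; the integral of the dual weight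
  \<open>V powr (- 1 / (\<sigma> - 1))\<close> that appears is controlled by the \<open>A\<^sub>\<sigma>\<close> condition. Both factors of that
  condition are positive on a set of positive measure, hence both are finite.
\<close>
lemma average_bound_A_sigma:
  assumes [measurable]: "V \<in> borel_measurable \<mu>" and Q [measurable]: "Q \<in> sets \<mu>"
    and V0: "\<And>y. 0 < V y" and Q0: "emeasure \<mu> Q \<noteq> 0" and m: "0 < m" and C: "0 < C" and \<sigma>: "1 < \<sigma>"
    and A\<sigma>: "(\<integral>\<^sup>+y\<in>Q. ennreal (V y) \<partial>\<mu>) / ennreal m
      * epowr ((\<integral>\<^sup>+y\<in>Q. ennreal (V y powr (- 1 / (\<sigma> - 1))) \<partial>\<mu>) / ennreal m) (\<sigma> - 1) \<le> ennreal C"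
  shows "average_bound \<mu> V \<sigma> Q m C"
proof -
  define g where "g y = V y powr (- 1 / (\<sigma> - 1))" for y
  have g [measurable]: "g \<in> borel_measurable \<mu>" unfolding g_def by measurable
  have g0: "0 < g y" for y unfolding g_def using V0[of y] by simp
  define A where "A = (\<integral>\<^sup>+y\<in>Q. ennreal (V y) \<partial>\<mu>)"
  define W where "W = (\<integral>\<^sup>+y\<in>Q. ennreal (g y) \<partial>\<mu>)"
  have AW: "A / ennreal m * epowr (W / ennreal m) (\<sigma> - 1) \<le> ennreal C"
    using A\<sigma> unfolding A_def W_def g_def .
  have A0: "A \<noteq> 0" unfolding A_def by (rule nn_integral_pos_on) (use V0 Q0 in auto)
  have W0: "W \<noteq> 0" unfolding W_def by (rule nn_integral_pos_on) (use g0 Q0 in auto)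
  have "epowr (W / ennreal m) (\<sigma> - 1) \<noteq> 0"
  proof (cases W)
    case (real u)
    then show ?thesis using W0 m by (simp add: divide_ennreal)
  next
    case top
    then show ?thesis by (simp add: ennreal_top_divide)
  qed
  then have "A \<noteq> top" using AW by (auto simp: ennreal_top_divide ennreal_top_mult top_unique)
  then obtain N where N: "A = ennreal N" "0 < N" using A0 by (cases A) (auto simp: less_le)
  have "W \<noteq> top"
    using AW N m by (auto simp: ennreal_top_divide divide_ennreal ennreal_mult_top top_unique)
  then obtain u where u: "W = ennreal u" "0 < u" using W0 by (cases W) (auto simp: less_le)
  have "ennreal (N / m * (u / m) powr (\<sigma> - 1)) \<le> ennreal C"
  proof -
    have "ennreal (N / m * (u / m) powr (\<sigma> - 1)) = ennreal (N / m) * ennreal ((u / m) powr (\<sigma> - 1))"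
      using N m by (intro ennreal_mult) auto
    also have "\<dots> = A / ennreal m * epowr (W / ennreal m) (\<sigma> - 1)"
      using N u m by (simp add: divide_ennreal)
    finally show ?thesis using AW by simp
  qed
  then have "N / m * (u / m) powr (\<sigma> - 1) \<le> C" using C by (subst (asm) ennreal_le_iff) auto
  moreover have "m powr \<sigma> = m * m powr (\<sigma> - 1)" using m by (simp add: powr_diff)
  ultimately have Nu: "N * u powr (\<sigma> - 1) \<le> C * m powr \<sigma>"
    using m u by (simp add: powr_divide divide_le_eq mult_ac)
  have "\<exists>Y\<ge>0. (\<integral>\<^sup>+y\<in>Q. ennreal (h y) \<partial>\<mu>) = ennreal Y \<and> Y powr \<sigma> * N \<le> C * m powr \<sigma> * I"
    if h [measurable]: "h \<in> borel_measurable \<mu>" and h0: "\<And>y. 0 \<le> h y" and I: "0 \<le> I"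
      "(\<integral>\<^sup>+y\<in>Q. ennreal (h y powr \<sigma> * V y) \<partial>\<mu>) \<le> ennreal I" for h I
  proof -
    have "(\<integral>\<^sup>+y\<in>Q. ennreal (h y) \<partial>\<mu>) =
      (\<integral>\<^sup>+y. ennreal ((h y powr \<sigma> * V y * indicator Q y) powr (1 / \<sigma>) * (g y * indicator Q y) powr (1 - 1 / \<sigma>)) \<partial>\<mu>)"
    proof (rule nn_integral_cong)
      fix y
      have "(- 1 / (\<sigma> - 1)) * (1 - 1 / \<sigma>) = - (1 / \<sigma>)" using \<sigma> by (simp add: divide_simps)
      then have "g y powr (1 - 1 / \<sigma>) = V y powr (- (1 / \<sigma>))" unfolding g_def by (simp only: powr_powr)
      moreover have "(h y powr \<sigma> * V y) powr (1 / \<sigma>) = h y * V y powr (1 / \<sigma>)"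
        using h0[of y] V0[of y] \<sigma> by (simp add: powr_mult powr_powr)
      moreover have "V y powr (1 / \<sigma>) * V y powr (- (1 / \<sigma>)) = 1"
        using V0[of y] by (simp add: powr_add[symmetric])
      ultimately have "(h y powr \<sigma> * V y) powr (1 / \<sigma>) * g y powr (1 - 1 / \<sigma>) = h y" by (simp add: mult.assoc)
      then show "ennreal (h y) * indicator Q y = ennreal ((h y powr \<sigma> * V y * indicator Q y) powr (1 / \<sigma>) * (g y * indicator Q y) powr (1 - 1 / \<sigma>))"
        by (cases "y \<in> Q") auto
    qed
    also have "\<dots> \<le> ennreal (I powr (1 / \<sigma>) * u powr (1 - 1 / \<sigma>))"
    proof (rule nn_integral_Hoelder)
      show "(\<integral>\<^sup>+y. ennreal (h y powr \<sigma> * V y * indicator Q y) \<partial>\<mu>) \<le> ennreal I"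
        using I(2) by (simp add: ennreal_mult'' ennreal_indicator)
      show "(\<integral>\<^sup>+y. ennreal (g y * indicator Q y) \<partial>\<mu>) \<le> ennreal u"
        using u(1) unfolding W_def by (simp add: ennreal_mult'' ennreal_indicator)
      show "0 \<le> g y * indicator Q y" for y using g0[of y] by (simp add: indicator_def less_imp_le)
      show "0 \<le> h y powr \<sigma> * V y * indicator Q y" for y using V0[of y] by (simp add: indicator_def less_imp_le)
    qed (use \<sigma> u I in auto)
    finally have le: "(\<integral>\<^sup>+y\<in>Q. ennreal (h y) \<partial>\<mu>) \<le> ennreal (I powr (1 / \<sigma>) * u powr (1 - 1 / \<sigma>))" .
    then obtain Y where Y: "0 \<le> Y" "(\<integral>\<^sup>+y\<in>Q. ennreal (h y) \<partial>\<mu>) = ennreal Y"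
      by (cases "(\<integral>\<^sup>+y\<in>Q. ennreal (h y) \<partial>\<mu>)") (auto simp: top_unique)
    then have "Y \<le> I powr (1 / \<sigma>) * u powr (1 - 1 / \<sigma>)" using le by (subst (asm) Y(2), subst (asm) ennreal_le_iff) auto
    then have "Y powr \<sigma> \<le> (I powr (1 / \<sigma>) * u powr (1 - 1 / \<sigma>)) powr \<sigma>"
      using Y(1) \<sigma> by (intro powr_mono2) auto
    also have "\<dots> = I * u powr (\<sigma> - 1)"
      using I(1) \<sigma> u by (simp add: powr_mult powr_powr left_diff_distrib)
    finally have "Y powr \<sigma> * N \<le> I * u powr (\<sigma> - 1) * N" using N(2) by (intro mult_right_mono) auto
    also have "\<dots> = I * (N * u powr (\<sigma> - 1))" by (simp add: mult_ac)
    also have "\<dots> \<le> I * (C * m powr \<sigma>)" using Nu I(1) by (rule mult_left_mono)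
    finally show ?thesis using Y by (intro exI[of _ Y]) (auto simp: mult_ac)
  qed
  then show ?thesis using N unfolding average_bound_def A_def[symmetric] by auto
qed

text \<open>
  Cubes whose trace on \<open>\<Omega>\<close> is null satisfy the bound trivially; for the others the cube itself has positive
  finite measure and the two preceding lemmas apply.
\<close>
lemma muckenhoupt_average_bound:
  fixes \<mu> :: "(real ^ 'n) measure"
  assumes \<mu>: "sets borel \<subseteq> sets \<mu>" and \<Omega>: "\<Omega> \<in> sets \<mu>"
    and fin: "\<forall>x\<in>\<Omega>. \<forall>l>0. emeasure \<mu> (cube x l) < \<infinity>"
    and \<sigma>: "1 \<le> \<sigma>" and V: "V \<in> borel_measurable \<mu>" and V0: "\<And>y. 0 < V y"
    and muck: "muckenhoupt \<mu> \<Omega> \<sigma> V"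
  shows "\<exists>C>0. \<forall>z\<in>\<Omega>. \<forall>l>0. average_bound \<mu> V \<sigma> (cube z l \<inter> \<Omega>) (measure \<mu> (cube z l)) C"
proof -
  have cube: "cube z l \<in> sets \<mu>" for z l using open_in_sets[OF \<mu> open_cube] .
  then have Q: "cube z l \<inter> \<Omega> \<in> sets \<mu>" for z l using \<Omega> by blast
  have em: "emeasure \<mu> (cube z l) = ennreal (measure \<mu> (cube z l))" if "z \<in> \<Omega>" "0 < l" for z l
    using fin that by (intro emeasure_eq_ennreal_measure) (auto simp: less_top)
  have m: "0 < measure \<mu> (cube z l)" if "z \<in> \<Omega>" "0 < l" "emeasure \<mu> (cube z l \<inter> \<Omega>) \<noteq> 0" for z l
  proof -
    have "emeasure \<mu> (cube z l \<inter> \<Omega>) \<le> emeasure \<mu> (cube z l)" using cube by (intro emeasure_mono) auto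
    then have "emeasure \<mu> (cube z l) \<noteq> 0" using that(3) by auto
    then show ?thesis unfolding em[OF that(1,2)] by (simp add: ennreal_eq_0_iff not_le)
  qed
  obtain C where C: "0 < C" and "\<forall>z\<in>\<Omega>. \<forall>l>0. emeasure \<mu> (cube z l \<inter> \<Omega>) \<noteq> 0 \<longrightarrow>
      average_bound \<mu> V \<sigma> (cube z l \<inter> \<Omega>) (measure \<mu> (cube z l)) C"
  proof (cases "\<sigma> = 1")
    case True
    then obtain C where C: "0 < C" and A1: "\<And>z l. z \<in> \<Omega> \<Longrightarrow> 0 < l \<Longrightarrow> AE x in \<mu>. x \<in> cube z l \<inter> \<Omega> \<longrightarrow>
            (\<integral>\<^sup>+y\<in>cube z l \<inter> \<Omega>. ennreal (V y) \<partial>\<mu>) / emeasure \<mu> (cube z l) \<le> ennreal (C * V x)"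
      using muck unfolding muckenhoupt_def by auto
    have "average_bound \<mu> V 1 (cube z l \<inter> \<Omega>) (measure \<mu> (cube z l)) C"
      if zl: "z \<in> \<Omega>" "0 < l" "emeasure \<mu> (cube z l \<inter> \<Omega>) \<noteq> 0" for z l
      using A1[OF zl(1,2)] unfolding em[OF zl(1,2)]
      by (rule average_bound_A1[OF V Q V0 zl(3) m[OF zl] C])
    then show ?thesis using that[OF C] True by blast
  next
    case False
    then obtain C where C: "0 < C" and A\<sigma>: "\<And>z l. z \<in> \<Omega> \<Longrightarrow> 0 < l \<Longrightarrow>
          ((\<integral>\<^sup>+y\<in>cube z l \<inter> \<Omega>. ennreal (V y) \<partial>\<mu>) / emeasure \<mu> (cube z l))
          * epowr ((\<integral>\<^sup>+y\<in>cube z l \<inter> \<Omega>. ennreal (V y powr (- 1 / (\<sigma> - 1))) \<partial>\<mu>)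
                     / emeasure \<mu> (cube z l)) (\<sigma> - 1) \<le> ennreal C"
      using muck unfolding muckenhoupt_def by auto
    have "average_bound \<mu> V \<sigma> (cube z l \<inter> \<Omega>) (measure \<mu> (cube z l)) C"
      if zl: "z \<in> \<Omega>" "0 < l" "emeasure \<mu> (cube z l \<inter> \<Omega>) \<noteq> 0" for z l
      using A\<sigma>[OF zl(1,2)] False \<sigma> unfolding em[OF zl(1,2)]
      by (intro average_bound_A_sigma[OF V Q V0 zl(3) m[OF zl] C]) auto
    then show ?thesis using that[OF C] by blast
  qed
  then show ?thesis using Q average_bound_null by (metis C less_imp_le null_setsI)
qed

section \<open>Freezing a log-Hoelder continuous exponent\<close>

text \<open>
  On a cube of small side \<open>l\<close> the oscillation \<open>d\<close> of \<open>s\<close> is at most a constant over \<open>ln (1 / l)\<close>, while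
  \<open>A / \<mu>(Q)\<close> is at most a constant times \<open>l powr (- \<beta>)\<close>; so \<open>d * ln (A / \<mu>(Q))\<close> stays bounded. On large cubes
  \<open>\<mu>(Q)\<close> is bounded below and the total oscillation \<open>P\<close> serves as \<open>d\<close>.
\<close>
lemma log_hoelder_lower_ahlfors:
  fixes \<mu> :: "(real ^ 'n) measure" and s :: "real ^ 'n \<Rightarrow> real"
  assumes \<mu>: "sets borel \<subseteq> sets \<mu>" and bdd: "bounded \<Omega>"
    and fin: "\<forall>x\<in>\<Omega>. \<forall>l>0. emeasure \<mu> (cube x l) < \<infinity>"
    and ahlfors: "lower_ahlfors \<mu> \<beta> \<Omega>" and hoelder: "log_hoelder_on \<Omega> s" and \<beta>: "0 < \<beta>"
    and P: "0 \<le> P" "\<And>x y. x \<in> \<Omega> \<Longrightarrow> y \<in> \<Omega> \<Longrightarrow> s x - s y \<le> P" and A: "0 < A"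
  shows "\<exists>B\<ge>1. \<forall>x\<in>\<Omega>. \<forall>l>0. \<exists>d\<ge>0. (\<forall>y\<in>\<Omega> \<inter> cube x l. s x - d \<le> s y) \<and>
    max 1 (A / measure \<mu> (cube x l)) powr d \<le> B"
proof (cases "diameter \<Omega> = 0")
  case True
  have "x = y" if "x \<in> \<Omega>" "y \<in> \<Omega>" for x y
    using diameter_bounded_bound[OF bdd that] True by simp
  then have "\<forall>x\<in>\<Omega>. \<forall>l>0. \<exists>d\<ge>0. (\<forall>y\<in>\<Omega> \<inter> cube x l. s x - d \<le> s y) \<and>
    max 1 (A / measure \<mu> (cube x l)) powr d \<le> 1"
    by (intro ballI allI impI exI[of _ 0]) auto
  then show ?thesis by blast
next
  case False
  define D where "D = diameter \<Omega>"
  have D: "0 < D" using False diameter_ge_0[OF bdd] unfolding D_def by simp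
  obtain c where c: "0 < c" and cl: "\<And>x l. x \<in> \<Omega> \<Longrightarrow> 0 < l \<Longrightarrow> l < D \<Longrightarrow> ennreal (c * l powr \<beta>) \<le> emeasure \<mu> (cube x l)"
    using ahlfors unfolding lower_ahlfors_def D_def by blast
  obtain H where H: "0 < H" and Hs: "\<And>x y. x \<in> \<Omega> \<Longrightarrow> y \<in> \<Omega> \<Longrightarrow> dist x y \<le> 1 / 2 \<Longrightarrow> \<bar>s x - s y\<bar> \<le> H / ln (1 / dist x y)"
    using hoelder unfolding log_hoelder_on_def by blast
  define N where "N = real CARD('n)"
  have N: "1 \<le> N" unfolding N_def by (simp add: Suc_leI)
  \<comment> \<open>The bound \<open>D / 2\<close> keeps the side in the range of the Ahlfors condition. The other bound
    gives \<open>dist x y \<le> 1 / 2\<close> and \<open>(dist x y)\<^sup>2 \<le> l\<close> on cubes of side \<open>l \<le> l0\<close>.\<close>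
  define l0 where "l0 = min (D / 2) (1 / (1 + N)\<^sup>2)"
  have l0: "0 < l0" "l0 < D" "l0 < 1" "N * l0 \<le> 1" "N\<^sup>2 * l0 \<le> 1"
  proof -
    show "0 < l0" "l0 < D" unfolding l0_def using D N by auto
    have "1 < (1 + N)\<^sup>2" using N by (simp add: one_less_power)
    then have "1 / (1 + N)\<^sup>2 < 1" by (subst divide_less_eq_1_pos) auto
    then show "l0 < 1" unfolding l0_def by linarith
    have "l0 \<le> 1 / (1 + N)\<^sup>2" unfolding l0_def by simp
    then have "l0 * (1 + N)\<^sup>2 \<le> 1" using N by (simp add: pos_le_divide_eq)
    moreover have "N * l0 \<le> l0 * (1 + N)\<^sup>2" "N\<^sup>2 * l0 \<le> l0 * (1 + N)\<^sup>2"
      using N \<open>0 < l0\<close> by (auto simp: power2_eq_square algebra_simps)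
    ultimately show "N * l0 \<le> 1" "N\<^sup>2 * l0 \<le> 1" by linarith+
  qed
  have lower: "c * min l l0 powr \<beta> \<le> measure \<mu> (cube x l)" if x: "x \<in> \<Omega>" "0 < l" for x l
  proof -
    have "ennreal (c * min l l0 powr \<beta>) \<le> emeasure \<mu> (cube x (min l l0))"
      using cl[of x "min l l0"] x l0 by simp
    also have "\<dots> \<le> emeasure \<mu> (cube x l)"
      by (intro emeasure_mono cube_mono open_in_sets[OF \<mu> open_cube]) simp
    also have "\<dots> = ennreal (measure \<mu> (cube x l))"
      using fin x by (intro emeasure_eq_ennreal_measure) (auto simp: less_top)
    finally show ?thesis by simp
  qed
  define B1 where "B1 = exp (2 * H * (\<bar>ln (A / c)\<bar> / ln (1 / l0) + \<beta>))"
  define B2 where "B2 = max 1 (A / (c * l0 powr \<beta>)) powr P"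
  have "\<exists>d\<ge>0. (\<forall>y\<in>\<Omega> \<inter> cube x l. s x - d \<le> s y) \<and> max 1 (A / measure \<mu> (cube x l)) powr d \<le> max 1 (max B1 B2)"
    if x: "x \<in> \<Omega>" "0 < l" for x l
  proof (cases "l < l0")
    case True
    have L: "0 < ln (1 / l0)" "ln (1 / l0) \<le> ln (1 / l)"
      using l0 True x by (auto simp: ln_gt_zero_iff field_simps intro!: ln_mono)
    define d where "d = 2 * H / ln (1 / l)"
    have d: "0 \<le> d" unfolding d_def using H L by simp
    have "s x - d \<le> s y" if y: "y \<in> \<Omega> \<inter> cube x l" for y
    proof (cases "x = y")
      case False
      define e where "e = dist x y"
      have e: "0 < e" "e \<le> N * (l / 2)"
        using dist_le_of_mem_cube[of y x l] y False unfolding e_def N_def by auto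
      have "N * l \<le> N * l0" using True N by simp
      then have "e \<le> 1 / 2" using e(2) l0(4) by simp
      have "e\<^sup>2 \<le> (N * (l / 2))\<^sup>2" using e by (intro power_mono) auto
      also have "\<dots> = (N\<^sup>2 * l) * (l / 4)" by (simp add: power2_eq_square)
      also have "\<dots> \<le> (N\<^sup>2 * l0) * (l / 4)" using True x by (intro mult_right_mono mult_left_mono) auto
      also have "\<dots> \<le> 1 * (l / 4)" using l0(5) x by (intro mult_right_mono) auto
      also have "\<dots> \<le> l" using x by simp
      finally have "ln (e\<^sup>2) \<le> ln l" using e(1) x by simp
      then have le: "ln (1 / l) \<le> 2 * ln (1 / e)" using e(1) x by (simp add: ln_div ln_realpow)
      have "s x - s y \<le> H / ln (1 / e)"
        using Hs[of x y] x y \<open>e \<le> 1 / 2\<close> unfolding e_def by auto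
      also have "\<dots> \<le> H / (ln (1 / l) / 2)" using le L H by (intro divide_left_mono mult_pos_pos) auto
      also have "\<dots> = d" unfolding d_def by simp
      finally show ?thesis by simp
    qed (use d in simp)
    moreover have "max 1 (A / measure \<mu> (cube x l)) powr d \<le> B1"
    proof -
      have low: "c * l powr \<beta> \<le> measure \<mu> (cube x l)" using lower[OF x] True by simp
      have pos: "0 < c * l powr \<beta>" using c x by simp
      have "A / measure \<mu> (cube x l) \<le> A / (c * l powr \<beta>)"
        using divide_left_mono[OF low less_imp_le[OF A] mult_pos_pos[OF less_le_trans[OF pos low] pos]] .
      then have "max 1 (A / measure \<mu> (cube x l)) \<le> max 1 (A / (c * l powr \<beta>))" by linarith
      also have "\<dots> \<le> exp (\<bar>ln (A / c)\<bar> + \<beta> * ln (1 / l))"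
      proof -
        have "A / (c * l powr \<beta>) = exp (ln (A / c) + \<beta> * ln (1 / l))"
        proof -
          have "ln (1 / l) = - ln l" using x by (simp add: ln_div)
          moreover have "exp (ln (A / c)) = A / c" using A c by simp
          moreover have "exp (\<beta> * - ln l) = 1 / l powr \<beta>" using x by (simp add: powr_def exp_minus divide_inverse)
          ultimately show ?thesis by (simp only: exp_add) simp
        qed
        moreover have "0 \<le> \<beta> * ln (1 / l)" using \<beta> L by simp
        ultimately show ?thesis by (auto simp: one_le_exp_iff)
      qed
      finally have "max 1 (A / measure \<mu> (cube x l)) powr d \<le> exp (\<bar>ln (A / c)\<bar> + \<beta> * ln (1 / l)) powr d"
        using d by (intro powr_mono2) auto
      also have "\<dots> = exp (d * (\<bar>ln (A / c)\<bar> + \<beta> * ln (1 / l)))" by (simp add: powr_def)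
      also have "\<dots> \<le> B1"
      proof -
        have "d * (\<bar>ln (A / c)\<bar> + \<beta> * ln (1 / l)) = 2 * H * (\<bar>ln (A / c)\<bar> / ln (1 / l) + \<beta>)"
          unfolding d_def using L by (simp add: field_simps)
        also have "\<dots> \<le> 2 * H * (\<bar>ln (A / c)\<bar> / ln (1 / l0) + \<beta>)"
          using H L by (intro mult_left_mono add_right_mono divide_left_mono mult_pos_pos) auto
        finally show ?thesis unfolding B1_def by simp
      qed
      finally show ?thesis .
    qed
    ultimately show ?thesis using d by (intro exI[of _ d]) auto
  next
    case False
    then have low: "c * l0 powr \<beta> \<le> measure \<mu> (cube x l)" using lower[OF x] by (simp add: min_absorb2)
    have pos: "0 < c * l0 powr \<beta>" using c l0 by simp
    have "A / measure \<mu> (cube x l) \<le> A / (c * l0 powr \<beta>)"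
      using divide_left_mono[OF low less_imp_le[OF A] mult_pos_pos[OF less_le_trans[OF pos low] pos]] .
    then have "max 1 (A / measure \<mu> (cube x l)) powr P \<le> B2"
      unfolding B2_def using P(1) by (intro powr_mono2) auto
    moreover have "s x - P \<le> s y" if "y \<in> \<Omega>" for y using P(2)[OF x(1) that] by simp
    ultimately show ?thesis using P(1) by (intro exI[of _ P]) auto
  qed
  then show ?thesis by (intro exI[of _ "max 1 (max B1 B2)"]) auto
qed

section \<open>Pointwise domination of averages with a variable exponent\<close>

lemma average_boundE:
  assumes "average_bound \<mu> V \<sigma> Q m C" "h \<in> borel_measurable \<mu>" "\<And>y. 0 \<le> h y" "0 \<le> I"
    "(\<integral>\<^sup>+y\<in>Q. ennreal (h y powr \<sigma> * V y) \<partial>\<mu>) \<le> ennreal I"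
  obtains Y where "0 \<le> Y" "(\<integral>\<^sup>+y\<in>Q. ennreal (h y) \<partial>\<mu>) = ennreal Y"
    "Y powr \<sigma> * enn2real (\<integral>\<^sup>+y\<in>Q. ennreal (V y) \<partial>\<mu>) \<le> C * m powr \<sigma> * I"
  using assms unfolding average_bound_def by blast

definition weight_measure :: "'a measure \<Rightarrow> 'a set \<Rightarrow> ('a \<Rightarrow> real) \<Rightarrow> 'a measure" where
  "weight_measure \<mu> \<Omega> V = density \<mu> (\<lambda>y. ennreal (V y) * indicator \<Omega> y)"

lemma sets_weight_measure [simp, measurable_cong]: "sets (weight_measure \<mu> \<Omega> V) = sets \<mu>"
  by (simp add: weight_measure_def)

lemma nn_integral_weight_measure:
  assumes [measurable]: "V \<in> borel_measurable \<mu>" "\<Omega> \<in> sets \<mu>" "F \<in> borel_measurable \<mu>"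
  shows "(\<integral>\<^sup>+y. F y \<partial>weight_measure \<mu> \<Omega> V) = (\<integral>\<^sup>+y\<in>\<Omega>. ennreal (V y) * F y \<partial>\<mu>)"
  unfolding weight_measure_def by (subst nn_integral_density) (auto simp: mult_ac)

lemma emeasure_weight_measure:
  assumes [measurable]: "V \<in> borel_measurable \<mu>" "\<Omega> \<in> sets \<mu>" "Q \<in> sets \<mu>"
  shows "emeasure (weight_measure \<mu> \<Omega> V) Q = (\<integral>\<^sup>+y\<in>Q \<inter> \<Omega>. ennreal (V y) \<partial>\<mu>)"
  unfolding weight_measure_def
  by (subst emeasure_density) (auto simp: indicator_inter_arith mult_ac)

text \<open>
  Only the part of \<open>G\<close> above \<open>1\<close> is kept, so that this power is monotone in the exponent; with
  \<open>k = \<sigma> / r\<close> it is the function whose \<open>\<nu>\<close>-maximal function dominates.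
\<close>
definition large_power :: "('a \<Rightarrow> real) \<Rightarrow> ('a \<Rightarrow> real) \<Rightarrow> real \<Rightarrow> 'a \<Rightarrow> real" where
  "large_power G s k y = (if 1 \<le> G y then G y powr (k * s y) else 0)"

lemma bounded_subset_cube:
  fixes \<Omega> :: "(real ^ 'n) set"
  assumes "bounded \<Omega>"
  shows "\<exists>L>0. \<Omega> \<subseteq> cube x0 L"
proof -
  obtain e where "\<forall>y\<in>\<Omega>. dist x0 y \<le> e" using assms bounded_any_center by blast
  then have "\<Omega> \<subseteq> ball x0 ((2 * \<bar>e\<bar> + 2) / 2)" by (force simp: field_simps)
  also have "\<dots> \<subseteq> cube x0 (2 * \<bar>e\<bar> + 2)" by (rule ball_subset_cube) simp
  finally show ?thesis by (intro exI[of _ "2 * \<bar>e\<bar> + 2"]) simp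
qed

text \<open>
  Let \<open>Q\<close> be the cube, \<open>m\<close> its measure and \<open>Y1\<close>, \<open>Y2\<close> the integrals of the parts of \<open>G\<close> above and
  below \<open>1\<close>, so that \<open>Y2 \<le> m\<close>. If \<open>Y1 \<le> m\<close>, the average of \<open>G\<close> is at most \<open>2\<close>. Otherwise \<open>Y1 / m\<close> exceeds
  \<open>1\<close> and its power \<open>s x\<close> splits into two factors. The power \<open>s x - e\<close>, with \<open>e\<close> a lower bound of \<open>s\<close> on \<open>Q\<close>
  in \<open>E\<close>, is bounded by log-Hoelder continuity. The power \<open>e\<close> is bounded by passing from \<open>\<mu>\<close> to \<open>\<nu>\<close> with the
  \<open>A\<^sub>\<sigma>\<close> condition and then from the exponent \<open>\<sigma>\<close> to \<open>\<sigma> * e / r\<close> with Jensen's inequality, which is where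
  \<open>r \<le> s\<close> on \<open>E\<close> enters.
\<close>
lemma variable_maximal_pointwise:
  fixes \<mu> :: "(real ^ 'n) measure" and \<Omega> :: "(real ^ 'n) set" and s V :: "real ^ 'n \<Rightarrow> real"
  defines "\<nu> \<equiv> weight_measure \<mu> \<Omega> V"
  assumes \<mu>: "sets borel \<subseteq> sets \<mu>" and \<Omega>: "\<Omega> \<in> sets \<mu>" "bounded \<Omega>" "emeasure \<mu> \<Omega> \<noteq> 0"
    and fin: "\<forall>x\<in>\<Omega>. \<forall>l>0. emeasure \<mu> (cube x l) < \<infinity>"
    and ahlfors: "lower_ahlfors \<mu> \<beta> \<Omega>" "0 < \<beta>" and hoelder: "log_hoelder_on \<Omega> s"
    and s [measurable]: "s \<in> borel_measurable \<mu>" and sP: "\<And>y. y \<in> \<Omega> \<Longrightarrow> 1 \<le> s y \<and> s y \<le> P"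
    and E: "E \<subseteq> \<Omega>" and \<sigma>: "1 \<le> \<sigma>" "\<sigma> < r" and rs: "\<And>y. y \<in> E \<Longrightarrow> r \<le> s y"
    and V [measurable]: "V \<in> borel_measurable \<mu>" and V0: "\<And>y. 0 < V y"
    and muck: "muckenhoupt \<mu> \<Omega> \<sigma> V"
  shows "\<exists>B\<ge>1. \<forall>G\<in>borel_measurable \<mu>. (\<forall>y. 0 \<le> G y) \<longrightarrow> (\<forall>y. y \<notin> E \<longrightarrow> G y = 0) \<longrightarrow>
    (\<integral>\<^sup>+y. ennreal (G y powr s y * V y) \<partial>\<mu>) \<le> 1 \<longrightarrow>
    (\<forall>x\<in>E. \<forall>l>0. \<exists>Y\<ge>0. (\<integral>\<^sup>+y\<in>cube x l. ennreal (G y) \<partial>\<mu>) = ennreal Y \<and>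
      ennreal ((Y / measure \<mu> (cube x l)) powr s x) \<le>
        ennreal B * (1 + epowr (centred_maximal \<nu> (\<lambda>y. ennreal (large_power G s (\<sigma> / r) y)) x) (r / \<sigma>)))"
proof -
  have [measurable]: "\<Omega> \<in> sets \<mu>" by fact
  have cube [measurable]: "cube z l \<in> sets \<mu>" for z l using open_in_sets[OF \<mu> open_cube] .
  obtain C where C: "0 < C" and avg: "\<And>z l. z \<in> \<Omega> \<Longrightarrow> 0 < l \<Longrightarrow>
      average_bound \<mu> V \<sigma> (cube z l \<inter> \<Omega>) (measure \<mu> (cube z l)) C"
    using muckenhoupt_average_bound[OF \<mu> \<Omega>(1) fin \<sigma>(1) V V0 muck] by blast
  have "\<Omega> \<noteq> {}" using \<Omega>(3) by auto
  then obtain x0 where x0: "x0 \<in> \<Omega>" by blast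
  obtain L where L: "0 < L" "\<Omega> \<subseteq> cube x0 L" using bounded_subset_cube[OF \<Omega>(2)] by blast
  have cube_\<Omega>: "cube x0 L \<inter> \<Omega> = \<Omega>" using L(2) by blast
  define A0 where "A0 = (\<integral>\<^sup>+y\<in>\<Omega>. ennreal (V y) \<partial>\<mu>)"
  have avg0: "average_bound \<mu> V \<sigma> \<Omega> (measure \<mu> (cube x0 L)) C" using avg[OF x0 L(1)] unfolding cube_\<Omega> .
  have "A0 \<noteq> top" using avg0 unfolding average_bound_def A0_def by auto
  moreover have "A0 \<noteq> 0" unfolding A0_def by (rule nn_integral_pos_on) (use V0 \<Omega> in auto)
  ultimately obtain N0 where N0: "A0 = ennreal N0" "0 < N0" by (cases A0) (auto simp: less_le)
  \<comment> \<open>A bound for the integral over \<open>\<Omega>\<close> of the part of \<open>G\<close> above \<open>1\<close>, uniform in \<open>G\<close>; it comes from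
    the Muckenhoupt condition on a cube containing \<open>\<Omega>\<close>. The summand \<open>1\<close> only makes it positive.\<close>
  define A where "A = (C * measure \<mu> (cube x0 L) powr \<sigma> / N0) powr (1 / \<sigma>) + 1"
  have A: "0 < A" unfolding A_def by (simp add: add_nonneg_pos)
  have P: "1 \<le> P" using sP[OF x0] by linarith
  have "s y - s z \<le> P" if "y \<in> \<Omega>" "z \<in> \<Omega>" for y z using sP[OF that(1)] sP[OF that(2)] by linarith
  then have "\<exists>B\<ge>1. \<forall>x\<in>\<Omega>. \<forall>l>0. \<exists>d\<ge>0. (\<forall>y\<in>\<Omega> \<inter> cube x l. s x - d \<le> s y) \<and>
      max 1 (A / measure \<mu> (cube x l)) powr d \<le> B"
    using P by (intro log_hoelder_lower_ahlfors[OF \<mu> \<Omega>(2) fin ahlfors(1) hoelder ahlfors(2) _ _ A, of P]) auto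
  then obtain B0 where B0: "1 \<le> B0" and osc: "\<And>x l. x \<in> \<Omega> \<Longrightarrow> 0 < l \<Longrightarrow> \<exists>d\<ge>0. (\<forall>y\<in>\<Omega> \<inter> cube x l. s x - d \<le> s y) \<and>
      max 1 (A / measure \<mu> (cube x l)) powr d \<le> B0"
    by blast
  define B where "B = 2 powr P * (B0 * (1 + C) powr (P / \<sigma>))"
  have BC: "1 \<le> B0 * (1 + C) powr (P / \<sigma>)"
  proof -
    have "1 \<le> (1 + C) powr (P / \<sigma>)" using C P \<sigma> by (intro ge_one_powr_ge_zero) auto
    then show ?thesis using B0 mult_mono[of 1 B0 1 "(1 + C) powr (P / \<sigma>)"] by simp
  qed
  have two: "1 \<le> (2::real) powr P" using P by (intro ge_one_powr_ge_zero) auto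
  have B: "1 \<le> B" "2 powr P \<le> B" unfolding B_def using BC two mult_mono[of 1 "2 powr P" 1 "B0 * (1 + C) powr (P / \<sigma>)"] by auto
  have main: "\<exists>Y\<ge>0. (\<integral>\<^sup>+y\<in>cube x l. ennreal (G y) \<partial>\<mu>) = ennreal Y \<and>
      ennreal ((Y / measure \<mu> (cube x l)) powr s x) \<le>
        ennreal B * (1 + epowr (centred_maximal \<nu> (\<lambda>y. ennreal (large_power G s (\<sigma> / r) y)) x) (r / \<sigma>))"
    if G [measurable]: "G \<in> borel_measurable \<mu>" and G0: "\<And>y. 0 \<le> G y" and GE: "\<And>y. y \<notin> E \<Longrightarrow> G y = 0"
      and GV: "(\<integral>\<^sup>+y. ennreal (G y powr s y * V y) \<partial>\<mu>) \<le> 1" and x: "x \<in> E" and l: "0 < l" for G x l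
  proof -
    define G1 where "G1 y = (if 1 \<le> G y then G y else 0)" for y
    have G1 [measurable]: "G1 \<in> borel_measurable \<mu>" unfolding G1_def by measurable
    have G10: "0 \<le> G1 y" for y unfolding G1_def using G0 by simp
    have G1E: "y \<in> E" if "1 \<le> G y" for y using that GE[of y] by fastforce
    define K where "K y = large_power G s (\<sigma> / r) y" for y
    have K [measurable]: "K \<in> borel_measurable \<mu>" unfolding K_def large_power_def by measurable
    have K0: "0 \<le> K y" for y unfolding K_def large_power_def by simp
    have x\<Omega>: "x \<in> \<Omega>" using x E by blast
    define Q where "Q = cube x l \<inter> \<Omega>"
    have Q [measurable]: "Q \<in> sets \<mu>" unfolding Q_def by measurable
    define m where "m = measure \<mu> (cube x l)"
    have em: "emeasure \<mu> (cube x l) = ennreal m"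
      unfolding m_def using fin x\<Omega> l by (intro emeasure_eq_ennreal_measure) (auto simp: less_top)
    have Q_le: "emeasure \<mu> Q \<le> ennreal m" unfolding Q_def em[symmetric] by (intro emeasure_mono) auto
    have GQ: "(\<integral>\<^sup>+y\<in>cube x l. ennreal (G y) \<partial>\<mu>) = (\<integral>\<^sup>+y\<in>Q. ennreal (G y) \<partial>\<mu>)"
    proof (rule nn_integral_cong)
      fix y
      have "G y = 0" if "y \<notin> \<Omega>" using GE[of y] E that by blast
      then show "ennreal (G y) * indicator (cube x l) y = ennreal (G y) * indicator Q y"
        by (cases "y \<in> \<Omega>") (auto simp: Q_def indicator_def)
    qed
    have powers: "(\<integral>\<^sup>+y\<in>S. ennreal (G1 y powr k * V y) \<partial>\<mu>) \<le> 1"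
      if "\<And>y. y \<in> E \<Longrightarrow> k \<le> s y" for S k
    proof -
      have "(\<integral>\<^sup>+y\<in>S. ennreal (G1 y powr k * V y) \<partial>\<mu>) \<le> (\<integral>\<^sup>+y. ennreal (G y powr s y * V y) \<partial>\<mu>)"
      proof (rule nn_integral_mono)
        fix y
        have "G1 y powr k \<le> G y powr s y" 
          unfolding G1_def using G1E[of y] that[of y] by (auto intro: powr_mono)
        then show "ennreal (G1 y powr k * V y) * indicator S y \<le> ennreal (G y powr s y * V y)"
          using V0[of y] by (auto simp: indicator_def intro!: ennreal_leI mult_right_mono)
      qed
      then show ?thesis using GV by (rule order_trans)
    qed
    have \<sigma>s: "\<sigma> \<le> s y" if "y \<in> E" for y using rs[OF that] \<sigma>(2) by simp
    obtain Z where Z: "0 \<le> Z" "(\<integral>\<^sup>+y\<in>\<Omega>. ennreal (G1 y) \<partial>\<mu>) = ennreal Z"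
        "Z powr \<sigma> * N0 \<le> C * measure \<mu> (cube x0 L) powr \<sigma>"
    proof (rule average_boundE[OF avg0 G1 G10 zero_le_one])
      show "(\<integral>\<^sup>+y\<in>\<Omega>. ennreal (G1 y powr \<sigma> * V y) \<partial>\<mu>) \<le> ennreal 1"
        using powers[of \<sigma> \<Omega>, OF \<sigma>s] by simp
    qed (use that N0 in \<open>simp add: A0_def\<close>)
    have "Z = (Z powr \<sigma>) powr (1 / \<sigma>)" using Z(1) \<sigma>(1) by (simp add: powr_powr)
    also have "\<dots> \<le> (C * measure \<mu> (cube x0 L) powr \<sigma> / N0) powr (1 / \<sigma>)"
      using Z N0 \<sigma> by (intro powr_mono2) (auto simp: pos_le_divide_eq)
    finally have ZA: "Z \<le> A" unfolding A_def by simp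
    define I where "I = enn2real (\<integral>\<^sup>+y\<in>Q. ennreal (G1 y powr \<sigma> * V y) \<partial>\<mu>)"
    have "(\<integral>\<^sup>+y\<in>Q. ennreal (G1 y powr \<sigma> * V y) \<partial>\<mu>) \<noteq> top"
      using powers[of \<sigma> Q, OF \<sigma>s] by (auto simp: top_unique)
    then have I: "(\<integral>\<^sup>+y\<in>Q. ennreal (G1 y powr \<sigma> * V y) \<partial>\<mu>) = ennreal I" "0 \<le> I"
      unfolding I_def by (simp_all add: less_top)
    define N where "N = enn2real (\<integral>\<^sup>+y\<in>Q. ennreal (V y) \<partial>\<mu>)"
    have avgQ: "average_bound \<mu> V \<sigma> Q m C" using avg[OF x\<Omega> l] unfolding Q_def m_def .
    then have N: "(\<integral>\<^sup>+y\<in>Q. ennreal (V y) \<partial>\<mu>) = ennreal N" "0 \<le> N"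
      unfolding average_bound_def N_def by auto
    obtain Y1 where Y1: "0 \<le> Y1" "(\<integral>\<^sup>+y\<in>Q. ennreal (G1 y) \<partial>\<mu>) = ennreal Y1"
        "Y1 powr \<sigma> * N \<le> C * m powr \<sigma> * I"
      using average_boundE[OF avgQ G1 G10 I(2) eq_refl[OF I(1)]] unfolding N_def .
    have "ennreal Y1 \<le> ennreal Z"
      unfolding Y1(2)[symmetric] Z(2)[symmetric] by (intro nn_integral_mono) (auto simp: Q_def indicator_def)
    then have Y1A: "Y1 \<le> A" using Z(1) ZA by simp
    have G2: "(\<integral>\<^sup>+y\<in>Q. ennreal (G y - G1 y) \<partial>\<mu>) \<le> ennreal m"
    proof -
      have "(\<integral>\<^sup>+y\<in>Q. ennreal (G y - G1 y) \<partial>\<mu>) \<le> (\<integral>\<^sup>+y. indicator Q y \<partial>\<mu>)"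
        by (intro nn_integral_mono) (auto simp: G1_def indicator_def)
      then show ?thesis using Q_le by simp
    qed
    then obtain Y2 where Y2: "0 \<le> Y2" "(\<integral>\<^sup>+y\<in>Q. ennreal (G y - G1 y) \<partial>\<mu>) = ennreal Y2"
      by (cases "(\<integral>\<^sup>+y\<in>Q. ennreal (G y - G1 y) \<partial>\<mu>)") (auto simp: top_unique)
    have m0: "0 \<le> m" unfolding m_def by simp
    have Y2m: "Y2 \<le> m" using G2 Y2 m0 by simp
    have "(\<integral>\<^sup>+y\<in>Q. ennreal (G y) \<partial>\<mu>) = (\<integral>\<^sup>+y. ennreal (G1 y) * indicator Q y + ennreal (G y - G1 y) * indicator Q y \<partial>\<mu>)"
      using G0 by (intro nn_integral_cong) (auto simp: indicator_def G1_def)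
    also have "\<dots> = ennreal Y1 + ennreal Y2" by (subst nn_integral_add) (auto simp: Y1(2) Y2(2))
    finally have Y: "(\<integral>\<^sup>+y\<in>cube x l. ennreal (G y) \<partial>\<mu>) = ennreal (Y1 + Y2)"
      unfolding GQ using Y1(1) Y2(1) by simp
    define M where "M = centred_maximal \<nu> (\<lambda>y. ennreal (K y)) x"
    have "ennreal (((Y1 + Y2) / m) powr s x) \<le> ennreal B * (1 + epowr M (r / \<sigma>))"
    proof (cases "Y1 \<le> m")
      case True
      have "(Y1 + Y2) / m \<le> 2" using True Y2m m0 by (cases "m = 0") (auto simp: divide_le_eq)
      then have "((Y1 + Y2) / m) powr s x \<le> 2 powr s x"
        using Y1(1) Y2(1) m0 sP[OF x\<Omega>] by (intro powr_mono2) auto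
      also have "\<dots> \<le> 2 powr P" using sP[OF x\<Omega>] by (intro powr_mono) auto
      also have "\<dots> \<le> B" by (rule B)
      finally have "ennreal (((Y1 + Y2) / m) powr s x) \<le> ennreal B * 1" by (simp add: ennreal_leI)
      also have "\<dots> \<le> ennreal B * (1 + epowr M (r / \<sigma>))" by (intro mult_left_mono) auto
      finally show ?thesis .
    next
      case False
      then have Y1m: "m < Y1" by simp
      have "emeasure \<mu> Q \<noteq> 0"
      proof
        assume "emeasure \<mu> Q = 0"
        then have "(\<integral>\<^sup>+y\<in>Q. ennreal (G1 y) \<partial>\<mu>) = 0" using Q by (intro nn_integral_null_set) auto
        then show False using Y1 Y1m m0 by simp
      qed
      then have "0 < m" using Q_le m0 by (cases "m = 0") auto
      have "ennreal N \<noteq> 0" unfolding N(1)[symmetric] by (rule nn_integral_pos_on) (use V0 \<open>emeasure \<mu> Q \<noteq> 0\<close> in auto)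
      then have Npos: "0 < N" using N(2) by (simp add: less_le)
      obtain d where d: "0 \<le> d" "\<And>y. y \<in> \<Omega> \<inter> cube x l \<Longrightarrow> s x - d \<le> s y" "max 1 (A / m) powr d \<le> B0"
        using osc[OF x\<Omega> l] unfolding m_def by blast
      \<comment> \<open>A lower bound of \<open>s\<close> on the part of \<open>E\<close> in the cube, at distance at most \<open>d\<close> from \<open>s x\<close>.\<close>
      define e where "e = max r (s x - d)"
      have e: "r \<le> e" "e \<le> s x" "s x - e \<le> d" unfolding e_def using rs[OF x] d(1) by auto
      have es: "e \<le> s y" if "y \<in> E \<inter> cube x l" for y
        using that rs[of y] d(2)[of y] E unfolding e_def by auto
      have r0: "0 < r" using \<sigma> by simp
      define J where "J = enn2real (\<integral>\<^sup>+y\<in>Q. ennreal (V y) * ennreal (K y) \<partial>\<mu>)"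
      have KG1: "K y = G1 y powr (\<sigma> / r * s y)" for y
        unfolding K_def large_power_def G1_def by simp
      have "(\<integral>\<^sup>+y\<in>Q. ennreal (V y) * ennreal (K y) \<partial>\<mu>) \<le> (\<integral>\<^sup>+y. ennreal (G y powr s y * V y) \<partial>\<mu>)"
      proof (rule nn_integral_mono)
        fix y
        have "K y \<le> G y powr s y"
        proof (cases "1 \<le> G y")
          case True
          have "\<sigma> / r * s y \<le> 1 * s y"
            using \<sigma> sP[of y] G1E[OF True] E by (intro mult_right_mono) (auto simp: divide_le_eq)
          then show ?thesis using True unfolding K_def large_power_def by (auto intro: powr_mono)
        qed (simp add: K_def large_power_def)
        then have "V y * K y \<le> G y powr s y * V y" using V0[of y] by (simp add: mult.commute)
        then show "ennreal (V y) * ennreal (K y) * indicator Q y \<le> ennreal (G y powr s y * V y)"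
          using V0[of y] K0[of y] by (auto simp: indicator_def ennreal_mult[symmetric] intro!: ennreal_leI)
      qed
      then have "(\<integral>\<^sup>+y\<in>Q. ennreal (V y) * ennreal (K y) \<partial>\<mu>) \<noteq> top" using GV by (auto simp: top_unique)
      then have J: "(\<integral>\<^sup>+y\<in>Q. ennreal (V y) * ennreal (K y) \<partial>\<mu>) = ennreal J" "0 \<le> J"
        unfolding J_def by (simp_all add: less_top)
      have Jensen: "I \<le> J powr (r / e) * N powr (1 - r / e)"
      proof -
        have "ennreal I = (\<integral>\<^sup>+y. ennreal ((V y * G1 y powr (\<sigma> * e / r) * indicator Q y) powr (r / e) * (V y * indicator Q y) powr (1 - r / e)) \<partial>\<mu>)"
          unfolding I(1)[symmetric]
        proof (rule nn_integral_cong)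
          fix y
          have "V y powr (r / e) * V y powr (1 - r / e) = V y" using V0[of y] by (simp add: powr_add[symmetric])
          moreover have "(G1 y powr (\<sigma> * e / r)) powr (r / e) = G1 y powr \<sigma>" using r0 e(1) by (simp add: powr_powr)
          ultimately have "G1 y powr \<sigma> * V y = (V y * G1 y powr (\<sigma> * e / r)) powr (r / e) * V y powr (1 - r / e)"
            using V0[of y] by (simp add: powr_mult mult_ac)
          then show "ennreal (G1 y powr \<sigma> * V y) * indicator Q y = ennreal ((V y * G1 y powr (\<sigma> * e / r) * indicator Q y) powr (r / e) * (V y * indicator Q y) powr (1 - r / e))"
            by (cases "y \<in> Q") auto
        qed
        also have "\<dots> \<le> ennreal (J powr (r / e) * N powr (1 - r / e))"
        proof (rule nn_integral_Hoelder)
          show "(\<integral>\<^sup>+y. ennreal (V y * indicator Q y) \<partial>\<mu>) \<le> ennreal N"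
            using N(1) by (simp add: ennreal_mult'' ennreal_indicator)
          show "(\<integral>\<^sup>+y. ennreal (V y * G1 y powr (\<sigma> * e / r) * indicator Q y) \<partial>\<mu>) \<le> ennreal J"
            unfolding J(1)[symmetric]
          proof (rule nn_integral_mono)
            fix y
            have "G1 y powr (\<sigma> * e / r) \<le> K y" if "y \<in> Q"
            proof (cases "1 \<le> G y")
              case True
              have "e \<le> s y" using es[of y] G1E[OF True] that unfolding Q_def by simp
              then have "\<sigma> * e / r \<le> \<sigma> / r * s y" using \<sigma> r0 by (simp add: divide_right_mono)
              then show ?thesis using True unfolding KG1 by (auto simp: G1_def intro: powr_mono)
            qed (simp add: G1_def K0)
            then show "ennreal (V y * G1 y powr (\<sigma> * e / r) * indicator Q y) \<le> ennreal (V y) * ennreal (K y) * indicator Q y"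
              using V0[of y] K0[of y] by (auto simp: indicator_def ennreal_mult[symmetric] intro!: ennreal_leI)
          qed
          show "0 \<le> V y * G1 y powr (\<sigma> * e / r) * indicator Q y" for y using V0[of y] by (simp add: indicator_def less_imp_le)
          show "0 \<le> V y * indicator Q y" for y using V0[of y] by (simp add: indicator_def less_imp_le)
          show "0 \<le> r / e" "r / e \<le> 1" using r0 e(1) by (auto simp: divide_le_eq)
        qed (use J N in auto)
        finally show ?thesis by (subst (asm) ennreal_le_iff) auto
      qed
      have INJ: "(I / N) powr (e / \<sigma>) \<le> (J / N) powr (r / \<sigma>)"
      proof -
        have "I / N \<le> J powr (r / e) * N powr (1 - r / e) / N" using Jensen Npos by (intro divide_right_mono) auto
        also have "\<dots> = (J / N) powr (r / e)" using Npos J(2) by (simp add: powr_diff powr_divide)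
        finally have "(I / N) powr (e / \<sigma>) \<le> ((J / N) powr (r / e)) powr (e / \<sigma>)"
          using I(2) Npos e r0 \<sigma> by (intro powr_mono2) auto
        also have "\<dots> = (J / N) powr (r / \<sigma>)" using e r0 \<sigma> by (simp add: powr_powr)
        finally show ?thesis .
      qed
      have JM: "ennreal (J / N) \<le> M"
      proof -
        have "(\<integral>\<^sup>+y\<in>cube x l. ennreal (K y) \<partial>\<nu>) = ennreal J"
          unfolding \<nu>_def J(1)[symmetric]
          by (subst nn_integral_weight_measure) (auto simp: Q_def indicator_inter_arith mult_ac)
        moreover have "emeasure \<nu> (cube x l) = ennreal N"
          unfolding \<nu>_def N(1)[symmetric] Q_def by (rule emeasure_weight_measure) auto
        ultimately have "(\<integral>\<^sup>+y\<in>cube x l. ennreal (K y) \<partial>\<nu>) / emeasure \<nu> (cube x l) = ennreal (J / N)"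
          using Npos J(2) by (simp add: divide_ennreal)
        then show ?thesis unfolding M_def centred_maximal_def using l
          by (intro SUP_upper2[of l]) auto
      qed
      have Cpow: "C powr (e / \<sigma>) \<le> (1 + C) powr (P / \<sigma>)"
      proof -
        have "C powr (e / \<sigma>) \<le> (1 + C) powr (e / \<sigma>)" using C e r0 \<sigma> by (intro powr_mono2) auto
        also have "\<dots> \<le> (1 + C) powr (P / \<sigma>)"
          using C e(2) sP[OF x\<Omega>] \<sigma> by (intro powr_mono divide_right_mono) auto
        finally show ?thesis .
      qed
      have first: "(Y1 / m) powr (s x - e) \<le> B0"
      proof -
        have Ym1: "1 \<le> Y1 / m" using Y1m \<open>0 < m\<close> by simp
        have "(Y1 / m) powr (s x - e) \<le> (Y1 / m) powr d" using Ym1 e(3) by (intro powr_mono) auto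
        also have "\<dots> \<le> max 1 (A / m) powr d"
          using Ym1 Y1A \<open>0 < m\<close> d(1) by (intro powr_mono2) (auto simp: divide_right_mono le_max_iff_disj)
        finally show ?thesis using d(3) by simp
      qed
      have second: "(Y1 / m) powr e \<le> (1 + C) powr (P / \<sigma>) * (J / N) powr (r / \<sigma>)"
      proof -
        have "(Y1 / m) powr \<sigma> \<le> C * (I / N)"
          using Y1(3) Npos \<open>0 < m\<close> Y1(1) by (simp add: powr_divide divide_le_eq le_divide_eq mult_ac)
        then have "((Y1 / m) powr \<sigma>) powr (e / \<sigma>) \<le> (C * (I / N)) powr (e / \<sigma>)"
          using e r0 \<sigma> by (intro powr_mono2) auto
        also have "\<dots> = C powr (e / \<sigma>) * (I / N) powr (e / \<sigma>)" by (rule powr_mult)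
        also have "\<dots> \<le> (1 + C) powr (P / \<sigma>) * (J / N) powr (r / \<sigma>)"
          using Cpow INJ by (intro mult_mono) auto
        also have "((Y1 / m) powr \<sigma>) powr (e / \<sigma>) = (Y1 / m) powr e" using \<sigma>(1) by (simp add: powr_powr)
        finally show ?thesis .
      qed
      have "(Y1 + Y2) / m \<le> 2 * (Y1 / m)" using Y2m Y1m \<open>0 < m\<close> by (simp add: field_simps)
      then have "((Y1 + Y2) / m) powr s x \<le> (2 * (Y1 / m)) powr s x"
        using Y1(1) Y2(1) m0 sP[OF x\<Omega>] by (intro powr_mono2) auto
      also have "\<dots> = 2 powr s x * ((Y1 / m) powr (s x - e) * (Y1 / m) powr e)"
        by (simp only: powr_mult powr_add[symmetric] diff_add_cancel)
      also have "\<dots> \<le> 2 powr P * (B0 * ((1 + C) powr (P / \<sigma>) * (J / N) powr (r / \<sigma>)))"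
        using first second sP[OF x\<Omega>] B0 by (intro mult_mono powr_mono) auto
      also have "\<dots> = B * (J / N) powr (r / \<sigma>)" unfolding B_def by (simp add: mult_ac)
      finally have "ennreal (((Y1 + Y2) / m) powr s x) \<le> ennreal B * ennreal ((J / N) powr (r / \<sigma>))"
        using B(1) by (simp add: ennreal_mult[symmetric] ennreal_leI)
      also have "ennreal ((J / N) powr (r / \<sigma>)) = epowr (ennreal (J / N)) (r / \<sigma>)"
        using J(2) Npos by simp
      also have "\<dots> \<le> 1 + epowr M (r / \<sigma>)"
        using JM r0 \<sigma> by (intro add_increasing epowr_mono) auto
      finally show ?thesis by (simp add: mult_left_mono)
    qed
    then show ?thesis using Y Y1(1) Y2(1) unfolding m_def M_def K_def by (intro exI[of _ "Y1 + Y2"]) auto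
  qed
  show ?thesis using main B(1) by (intro exI[of _ B]) blast
qed

section \<open>Weights, norms and exponents\<close>

lemma borel_measurable_epowr [measurable]:
  assumes [measurable]: "f \<in> borel_measurable M"
  shows "(\<lambda>x. epowr (f x) a) \<in> borel_measurable M"
  unfolding epowr_def infinity_ennreal_def by measurable

lemma muckenhoupt_cong_AE:
  assumes muck: "muckenhoupt \<mu> \<Omega> \<sigma> v" and meas: "v' \<in> borel_measurable (restrict_space \<mu> \<Omega>)"
    and eq: "AE y in \<mu>. y \<in> \<Omega> \<longrightarrow> v y = v' y"
  shows "muckenhoupt \<mu> \<Omega> \<sigma> v'"
proof -
  have int: "(\<integral>\<^sup>+y\<in>Q \<inter> \<Omega>. F (v y) \<partial>\<mu>) = (\<integral>\<^sup>+y\<in>Q \<inter> \<Omega>. F (v' y) \<partial>\<mu>)" for Q and F :: "real \<Rightarrow> ennreal"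
  proof (rule nn_integral_cong_AE)
    show "AE y in \<mu>. F (v y) * indicator (Q \<inter> \<Omega>) y = F (v' y) * indicator (Q \<inter> \<Omega>) y"
      using eq by eventually_elim (auto simp: indicator_def)
  qed
  have w: "weight_on \<mu> \<Omega> v'"
  proof -
    have "AE y in \<mu>. y \<in> \<Omega> \<longrightarrow> 0 < v y" using muck unfolding muckenhoupt_def weight_on_def by blast
    then have "AE y in \<mu>. y \<in> \<Omega> \<longrightarrow> 0 < v' y" using eq by eventually_elim auto
    then show ?thesis using meas unfolding weight_on_def by blast
  qed
  show ?thesis
  proof (cases "\<sigma> = 1")
    case True
    then obtain C where C: "0 < C" "\<And>z l. z \<in> \<Omega> \<Longrightarrow> 0 < l \<Longrightarrow> AE x in \<mu>. x \<in> cube z l \<inter> \<Omega> \<longrightarrow>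
            (\<integral>\<^sup>+y\<in>cube z l \<inter> \<Omega>. ennreal (v y) \<partial>\<mu>) / emeasure \<mu> (cube z l) \<le> ennreal (C * v x)"
      using muck unfolding muckenhoupt_def by auto
    have "AE x in \<mu>. x \<in> cube z l \<inter> \<Omega> \<longrightarrow>
            (\<integral>\<^sup>+y\<in>cube z l \<inter> \<Omega>. ennreal (v' y) \<partial>\<mu>) / emeasure \<mu> (cube z l) \<le> ennreal (C * v' x)"
      if "z \<in> \<Omega>" "0 < l" for z l
      using C(2)[OF that] eq unfolding int[of ennreal] by eventually_elim auto
    then show ?thesis using w True C(1) unfolding muckenhoupt_def by auto
  next
    case False
    then show ?thesis
      using muck w int[where F = ennreal] int[where F = "\<lambda>u. ennreal (u powr (- 1 / (\<sigma> - 1)))"]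
      unfolding muckenhoupt_def by simp
  qed
qed

text \<open>
  The hypothesis carries the constant inside the modular, because the modular of \<open>h\<close> may not be divided by a
  constant by linearity of the integral when \<open>h\<close> is not known to be measurable.
\<close>
lemma lux_norm_transfer:
  assumes C: "0 < C"
    and step: "\<And>l. 0 < l \<Longrightarrow> modular \<mu> p E (\<lambda>x. g x / ennreal l) \<le> 1 \<Longrightarrow>
      modular \<mu> q E (\<lambda>x. h x / ennreal (C * l)) \<le> 1"
  shows "lux_norm \<mu> q E h \<le> ennreal C * lux_norm \<mu> p E g"
proof -
  have "lux_norm \<mu> q E h / ennreal C \<le> lux_norm \<mu> p E g"
    unfolding lux_norm_def[of \<mu> p]
  proof (rule Inf_greatest, clarify)
    fix l :: real assume l: "0 < l" "modular \<mu> p E (\<lambda>x. g x / ennreal l) \<le> 1"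
    have "lux_norm \<mu> q E h \<le> ennreal (C * l)"
      unfolding lux_norm_def using step[OF l] C l(1) by (intro Inf_lower) auto
    also have "\<dots> = ennreal l * ennreal C" using C l(1) by (simp add: ennreal_mult mult.commute)
    finally show "lux_norm \<mu> q E h / ennreal C \<le> ennreal l"
      using C by (intro divide_le_posI_ennreal) (auto simp: mult.commute)
  qed
  then have "lux_norm \<mu> q E h / ennreal C * ennreal C \<le> lux_norm \<mu> p E g * ennreal C"
    by (rule mult_right_mono) simp
  moreover have "lux_norm \<mu> q E h / ennreal C * ennreal C = lux_norm \<mu> q E h * (ennreal C / ennreal C)"
    by (simp add: ennreal_divide_times)
  moreover have "ennreal C / ennreal C = 1" using C by (intro ennreal_divide_self) auto
  ultimately show ?thesis by (simp add: mult.commute)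
qed

lemma lux_norm_null:
  assumes "E \<subseteq> Z" "Z \<in> null_sets \<mu>"
  shows "lux_norm \<mu> q E h = 0"
proof -
  have "modular \<mu> q E g = 0" for g
  proof -
    have "modular \<mu> q E g \<le> (\<integral>\<^sup>+x\<in>Z. epowr (g x) (q x) \<partial>\<mu>)"
      unfolding modular_def using assms(1) by (intro nn_integral_mono) (auto simp: indicator_def)
    then show ?thesis using nn_integral_null_set[OF assms(2)] by simp
  qed
  then have le: "lux_norm \<mu> q E h \<le> ennreal l" if "0 < l" for l
    unfolding lux_norm_def using that by (intro Inf_lower) auto
  have "lux_norm \<mu> q E h \<le> 0"
  proof (rule ennreal_le_epsilon)
    fix l :: real assume "0 < l"
    from le[OF this] show "lux_norm \<mu> q E h \<le> 0 + ennreal l" by simp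
  qed
  then show ?thesis by simp
qed

text \<open>
  The exponents match because \<open>(1 - a) / s = 1 / q\<close> and \<open>p * (a + 1 / q) = 1\<close>.
\<close>
lemma fractional_factorisation:
  fixes a p q s w u V F :: real
  assumes q: "1 / q = 1 / p - a" "0 < q" and p: "0 < p" and s: "s = q * (1 - a)" "0 < s"
    and w: "0 < w" and u: "0 \<le> u" and V: "V = w powr q" and F: "F = (w * u) powr p / V"
  shows "(F * V) powr a * (F powr (1 / s)) powr (1 - a) = u"
proof (cases "u = 0")
  case True
  then show ?thesis using F by simp
next
  case False
  then have u0: "0 < u" using u by simp
  have V0: "0 < V" using V w by simp
  have "(1 / s) * (1 - a) = 1 / q" using s q(2) by (auto simp: field_simps)
  then have "(F powr (1 / s)) powr (1 - a) = F powr (1 / q)" by (simp only: powr_powr)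
  also have "\<dots> = (w * u) powr (p / q) / w"
  proof -
    have "F powr (1 / q) = ((w * u) powr p) powr (1 / q) / V powr (1 / q)"
      unfolding F by (rule powr_divide)
    then show ?thesis unfolding V using q(2) w by (simp add: powr_powr)
  qed
  finally have "(F powr (1 / s)) powr (1 - a) = (w * u) powr (p / q) / w" .
  moreover have "(F * V) powr a = (w * u) powr (p * a)" unfolding F using V0 by (simp add: powr_powr)
  ultimately have "(F * V) powr a * (F powr (1 / s)) powr (1 - a) = (w * u) powr (p * a) * (w * u) powr (p / q) / w"
    by simp
  also have "\<dots> = (w * u) powr (p * a + p / q) / w" by (simp only: powr_add)
  also have "p * a + p / q = 1"
  proof -
    have "p * a + p / q = p * (a + 1 / q)" by (simp add: algebra_simps)
    then show ?thesis using q(1) p by simp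
  qed
  also have "(w * u) powr 1 / w = u" using w u0 by simp
  finally show ?thesis .
qed

text \<open>
  From \<open>1 / q x - 1 / q y = 1 / p x - 1 / p y\<close> the difference of \<open>q\<close> is that of \<open>p\<close> times
  \<open>q x * q y / (p x * p y)\<close>, a factor of at most \<open>k\<^sup>2\<close>.
\<close>
lemma log_hoelder_sobolev_exponent:
  fixes p q s :: "real ^ 'n \<Rightarrow> real"
  assumes p: "log_hoelder_on \<Omega> p" "\<And>x. x \<in> \<Omega> \<Longrightarrow> 1 \<le> p x" and a: "0 \<le> a" "a < 1"
    and q: "\<And>x. x \<in> \<Omega> \<Longrightarrow> 0 < q x \<and> q x \<le> k \<and> 1 / q x = 1 / p x - a"
    and s: "\<And>x. x \<in> \<Omega> \<Longrightarrow> s x = q x * (1 - a)"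
  shows "log_hoelder_on \<Omega> s"
proof -
  obtain H where H: "0 < H" "\<And>x y. x \<in> \<Omega> \<Longrightarrow> y \<in> \<Omega> \<Longrightarrow> dist x y \<le> 1 / 2 \<Longrightarrow> \<bar>p x - p y\<bar> \<le> H / ln (1 / dist x y)"
    using p(1) unfolding log_hoelder_on_def by blast
  have "\<bar>s x - s y\<bar> \<le> (k\<^sup>2 + 1) * H / ln (1 / dist x y)" if xy: "x \<in> \<Omega>" "y \<in> \<Omega>" "dist x y \<le> 1 / 2" for x y
  proof -
    have px: "0 < p x" "1 \<le> p x" and py: "0 < p y" "1 \<le> p y" using p(2)[OF xy(1)] p(2)[OF xy(2)] by auto
    have qx: "0 < q x" "q x \<le> k" and qy: "0 < q y" "q y \<le> k" using q[OF xy(1)] q[OF xy(2)] by auto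
    have "1 / q y - 1 / q x = 1 / p y - 1 / p x" using q[OF xy(1)] q[OF xy(2)] by simp
    then have "(q x - q y) / (q x * q y) = (p x - p y) / (p x * p y)"
      using px py qx qy by (simp add: diff_divide_distrib)
    then have "q x - q y = (q x * q y) * ((p x - p y) / (p x * p y))"
      using qx qy by (simp add: divide_eq_eq mult.commute)
    then have "\<bar>q x - q y\<bar> = (q x * q y) * (\<bar>p x - p y\<bar> / (p x * p y))"
      using px py qx qy by (simp add: abs_mult)
    also have "\<dots> \<le> (k * k) * (\<bar>p x - p y\<bar> / 1)"
      using px py qx qy by (intro mult_mono divide_left_mono) (auto intro: mult_ge1_I)
    also have "\<dots> \<le> (k\<^sup>2 + 1) * \<bar>p x - p y\<bar>" by (simp add: power2_eq_square algebra_simps)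
    also have "\<dots> \<le> (k\<^sup>2 + 1) * (H / ln (1 / dist x y))" using H(2)[OF xy] by (intro mult_left_mono) auto
    finally have "\<bar>q x - q y\<bar> \<le> (k\<^sup>2 + 1) * H / ln (1 / dist x y)" by simp
    moreover have "\<bar>s x - s y\<bar> = \<bar>q x - q y\<bar> * (1 - a)"
      unfolding s[OF xy(1)] s[OF xy(2)] using a by (simp add: abs_mult flip: left_diff_distrib)
    moreover have "\<bar>q x - q y\<bar> * (1 - a) \<le> \<bar>q x - q y\<bar> * 1" using a by (intro mult_left_mono) auto
    ultimately show ?thesis by (metis mult_1_right order_trans)
  qed
  moreover have "0 < k\<^sup>2 + 1" by (rule add_nonneg_pos) auto
  then have "0 < (k\<^sup>2 + 1) * H" using H(1) by (rule mult_pos_pos)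
  ultimately show ?thesis unfolding log_hoelder_on_def by blast
qed

section \<open>The fractional maximal operator\<close>

lemma finite_weight_measure:
  fixes \<mu> :: "(real ^ 'n) measure"
  assumes \<mu>: "sets borel \<subseteq> sets \<mu>" and \<Omega>: "\<Omega> \<in> sets \<mu>" "bounded \<Omega>"
    and fin: "\<forall>x\<in>\<Omega>. \<forall>l>0. emeasure \<mu> (cube x l) < \<infinity>"
    and \<sigma>: "1 \<le> \<sigma>" and V: "V \<in> borel_measurable \<mu>" and V0: "\<And>y. 0 < V y"
    and muck: "muckenhoupt \<mu> \<Omega> \<sigma> V"
  shows "finite_measure (weight_measure \<mu> \<Omega> V)"
proof (rule finite_measureI)
  have sp: "space (weight_measure \<mu> \<Omega> V) = UNIV"
    using space_of_borel_subset[OF \<mu>] by (simp add: weight_measure_def)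
  have "UNIV \<in> sets \<mu>" using space_of_borel_subset[OF \<mu>] sets.top[of \<mu>] by simp
  then have eq: "emeasure (weight_measure \<mu> \<Omega> V) UNIV = (\<integral>\<^sup>+y\<in>\<Omega>. ennreal (V y) \<partial>\<mu>)"
    using emeasure_weight_measure[OF V \<Omega>(1), of UNIV] by simp
  have "(\<integral>\<^sup>+y\<in>\<Omega>. ennreal (V y) \<partial>\<mu>) < \<infinity>"
  proof (cases "\<Omega> = {}")
    case False
    then obtain x where x: "x \<in> \<Omega>" by blast
    obtain L where L: "0 < L" "\<Omega> \<subseteq> cube x L" using bounded_subset_cube[OF \<Omega>(2)] by blast
    have "cube x L \<inter> \<Omega> = \<Omega>" using L(2) by blast
    then show ?thesis
      using muckenhoupt_average_bound[OF \<mu> \<Omega>(1) fin \<sigma> V V0 muck] x L(1)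
      unfolding average_bound_def by metis
  qed simp
  then show "emeasure (weight_measure \<mu> \<Omega> V) (space (weight_measure \<mu> \<Omega> V)) \<noteq> \<infinity>"
    unfolding sp eq by simp
qed

text \<open>
  With \<open>a = \<alpha> / \<beta>\<close>, Hoelder's inequality and \<open>\<integral> H \<le> 1\<close> bound the integral of \<open>\<bar>f\<bar>\<close> over a cube by \<open>c\<close> times
  the \<open>(1 - a)\<close>-th power of that of \<open>G\<close>, and \<open>m powr (1 - a)\<close> is exactly the normalisation of the fractional
  maximal function. The scale \<open>c\<close> is carried along, since \<open>f\<close> itself need not be measurable and is only known up
  to null sets.
\<close>
lemma scaled_fractional_maximal_le:
  fixes \<mu> :: "(real ^ 'n) measure"
  assumes \<mu>: "sets borel \<subseteq> sets \<mu>" and fin: "\<And>l. 0 < l \<Longrightarrow> emeasure \<mu> (cube x l) < \<infinity>"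
    and a: "0 \<le> \<alpha> / \<beta>" "\<alpha> / \<beta> < 1" and c: "0 < c" and q: "0 < q" and s: "s = q * (1 - \<alpha> / \<beta>)"
    and H [measurable]: "H \<in> borel_measurable \<mu>" and H0: "\<And>y. 0 \<le> H y" and H1: "(\<integral>\<^sup>+y. ennreal (H y) \<partial>\<mu>) \<le> 1"
    and G [measurable]: "G \<in> borel_measurable \<mu>" and G0: "\<And>y. 0 \<le> G y"
    and f: "AE y in \<mu>. \<bar>f y\<bar> = c * (H y powr (\<alpha> / \<beta>) * G y powr (1 - \<alpha> / \<beta>))"
    and GT: "\<And>l. 0 < l \<Longrightarrow> \<exists>Y\<ge>0. (\<integral>\<^sup>+y\<in>cube x l. ennreal (G y) \<partial>\<mu>) = ennreal Y \<and>
      ennreal ((Y / measure \<mu> (cube x l)) powr s) \<le> ennreal T" and T: "0 \<le> T"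
  shows "frac_maximal \<mu> \<beta> \<alpha> f x \<le> ennreal (c * T powr (1 / q))"
  unfolding frac_maximal_def
proof (rule SUP_least)
  fix l :: real assume "l \<in> {0<..}"
  then have l: "0 < l" by simp
  have cube [measurable]: "cube x l \<in> sets \<mu>" using open_in_sets[OF \<mu> open_cube] .
  define a where "a = \<alpha> / \<beta>"
  define m where "m = measure \<mu> (cube x l)"
  have em: "emeasure \<mu> (cube x l) = ennreal m"
    unfolding m_def using fin[OF l] by (intro emeasure_eq_ennreal_measure) (auto simp: less_top)
  have m0: "0 \<le> m" unfolding m_def by simp
  obtain Y where Y: "0 \<le> Y" "(\<integral>\<^sup>+y\<in>cube x l. ennreal (G y) \<partial>\<mu>) = ennreal Y" "(Y / m) powr s \<le> T"
    using GT[OF l] T unfolding m_def by auto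
  show "(\<integral>\<^sup>+y\<in>cube x l. ennreal \<bar>f y\<bar> \<partial>\<mu>) / epowr (emeasure \<mu> (cube x l)) (1 - \<alpha> / \<beta>) \<le> ennreal (c * T powr (1 / q))"
  proof (cases "m = 0")
    case True
    then have "cube x l \<in> null_sets \<mu>" using em cube by (intro null_setsI) auto
    then have "(\<integral>\<^sup>+y\<in>cube x l. ennreal \<bar>f y\<bar> \<partial>\<mu>) = 0" by (rule nn_integral_null_set)
    then show ?thesis by simp
  next
    case False
    then have m: "0 < m" using m0 by simp
    have "(\<integral>\<^sup>+y\<in>cube x l. ennreal \<bar>f y\<bar> \<partial>\<mu>) =
        (\<integral>\<^sup>+y. ennreal c * ennreal ((H y) powr a * (G y * indicator (cube x l) y) powr (1 - a)) \<partial>\<mu>)"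
    proof (rule nn_integral_cong_AE)
      show "AE y in \<mu>. ennreal \<bar>f y\<bar> * indicator (cube x l) y = ennreal c * ennreal ((H y) powr a * (G y * indicator (cube x l) y) powr (1 - a))"
        using f
      proof eventually_elim
        case (elim y)
        then show ?case using c by (cases "y \<in> cube x l") (auto simp: a_def ennreal_mult')
      qed
    qed
    also have "\<dots> = ennreal c * (\<integral>\<^sup>+y. ennreal ((H y) powr a * (G y * indicator (cube x l) y) powr (1 - a)) \<partial>\<mu>)"
      by (rule nn_integral_cmult) measurable
    also have "\<dots> \<le> ennreal c * ennreal (1 powr a * Y powr (1 - a))"
    proof (rule mult_left_mono[OF nn_integral_Hoelder])
      show "(\<integral>\<^sup>+y. ennreal (G y * indicator (cube x l) y) \<partial>\<mu>) \<le> ennreal Y"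
        using Y(2) by (simp add: ennreal_mult'' ennreal_indicator)
      show "0 \<le> G y * indicator (cube x l) y" for y using G0[of y] by (simp add: indicator_def)
    qed (use a H0 H1 Y(1) in \<open>auto simp: a_def\<close>)
    also have "\<dots> = ennreal (c * Y powr (1 - a))" using c by (simp add: ennreal_mult)
    finally have "(\<integral>\<^sup>+y\<in>cube x l. ennreal \<bar>f y\<bar> \<partial>\<mu>) / ennreal (m powr (1 - a)) \<le> ennreal (c * Y powr (1 - a)) / ennreal (m powr (1 - a))"
      by (rule divide_right_mono_ennreal)
    also have "\<dots> = ennreal (c * (Y / m) powr (1 - a))"
      using c m Y(1) by (simp add: divide_ennreal powr_divide)
    also have "\<dots> \<le> ennreal (c * T powr (1 / q))"
    proof (intro ennreal_leI mult_left_mono)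
      have "s * (1 / q) = 1 - a" using s q by (simp add: a_def)
      then have "(Y / m) powr (1 - a) = ((Y / m) powr s) powr (1 / q)" by (simp only: powr_powr)
      also have "\<dots> \<le> T powr (1 / q)" using Y(3) q by (intro powr_mono2) auto
      finally show "(Y / m) powr (1 - a) \<le> T powr (1 / q)" .
    qed (use c in simp)
    finally show ?thesis unfolding em a_def using m0 by simp
  qed
qed

theorem corollary1p7:
  fixes \<mu> :: "(real ^ 'n) measure" and \<Omega> :: "(real ^ 'n) set"
    and \<alpha> \<beta> r \<epsilon> :: real and p p' q s w :: "real ^ 'n \<Rightarrow> real"
  assumes "borel_regular \<mu>"
    and "\<forall>x\<in>\<Omega>. \<forall>l>0. emeasure \<mu> (cube x l) < \<infinity>"
    and "bounded \<Omega>" and "\<Omega> \<in> sets \<mu>"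
    and "0 \<le> \<alpha>" and "\<alpha> < \<beta>"
    and "lower_ahlfors \<mu> \<beta> \<Omega>"
    and "exponent_on \<mu> \<Omega> p" and "log_hoelder_on \<Omega> p"
    and "1 < (INF x\<in>\<Omega>. ereal (p x))"
    and "(SUP x\<in>\<Omega>. ereal (p x)) < (if \<alpha> = 0 then \<infinity> else ereal (\<beta> / \<alpha>))"
    and "\<forall>x\<in>\<Omega>. 1 / p x + 1 / p' x = 1"
    and "\<forall>x\<in>\<Omega>. 1 / q x = 1 / p x - \<alpha> / \<beta>"
    and "\<forall>x\<in>\<Omega>. s x = 1 + q x / p' x"
    and "1 < r" and "ereal r < (SUP x\<in>\<Omega>. ereal (s x))" and "0 < \<epsilon>"
    and "weight_on \<mu> \<Omega> w"
    and "\<exists>\<delta>. 0 < \<delta> \<and> \<delta> \<le> r - 1 \<and> muckenhoupt \<mu> \<Omega> (r - \<delta>) (\<lambda>x. w x powr q x)"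
  shows "\<exists>C>0. \<forall>f :: real ^ 'n \<Rightarrow> real.
      (\<lambda>x. w x * f x) \<in> Lp_var \<mu> p (superlevel_eps \<Omega> s r \<epsilon>) \<and>
      {x. f x \<noteq> 0} \<subseteq> superlevel_eps \<Omega> s r \<epsilon> \<longrightarrow>
      lux_norm \<mu> q (superlevel_eps \<Omega> s r \<epsilon>) (\<lambda>x. ennreal (w x) * frac_maximal \<mu> \<beta> \<alpha> f x)
        \<le> ennreal C * lux_norm \<mu> p (superlevel_eps \<Omega> s r \<epsilon>) (\<lambda>x. ennreal \<bar>w x * f x\<bar>)"
proof -
  note fin = assms(2) and bdd = assms(3) and \<Omega> [measurable] = assms(4) and ahlfors = assms(7)
  have \<mu>: "sets borel \<subseteq> sets \<mu>" using assms(1) unfolding borel_regular_def by blast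
  have sp: "space \<mu> = UNIV" by (rule space_of_borel_subset[OF \<mu>])
  define a where "a = \<alpha> / \<beta>"
  have \<beta>: "0 < \<beta>" using assms(5,6) by simp
  have a: "0 \<le> a" "a < 1" unfolding a_def using assms(5,6) \<beta> by auto
  define E where "E = superlevel_eps \<Omega> s r \<epsilon>"
  have E: "E \<subseteq> \<Omega>" "\<And>y. y \<in> E \<Longrightarrow> r < s y" unfolding E_def superlevel_eps_def superlevel_def by auto

  have p_ge: "1 \<le> p x" if "x \<in> \<Omega>" for x using assms(8) that unfolding exponent_on_def by blast
  obtain P where P: "\<And>x. x \<in> \<Omega> \<Longrightarrow> p x \<le> P" "a * P < 1" "1 \<le> P"
  proof -
    obtain R where R: "(SUP x\<in>\<Omega>. ereal (p x)) < ereal R" "ereal R < (if \<alpha> = 0 then \<infinity> else ereal (\<beta> / \<alpha>))"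
      using ereal_dense2[OF assms(11)] by blast
    have le: "p x \<le> R" if "x \<in> \<Omega>" for x
    proof -
      have "ereal (p x) \<le> (SUP x\<in>\<Omega>. ereal (p x))" using that by (rule SUP_upper)
      then have "ereal (p x) < ereal R" using R(1) by (rule le_less_trans)
      then show ?thesis by simp
    qed
    have "a * R < 1"
    proof (cases "\<alpha> = 0")
      case False
      then show ?thesis using R(2) assms(5) \<beta> unfolding a_def by (simp add: field_simps)
    qed (simp add: a_def)
    then have "a * max 1 R < 1" using a(2) by (simp add: max_def)
    moreover have "p x \<le> max 1 R" if "x \<in> \<Omega>" for x using le[OF that] by simp
    ultimately show ?thesis by (intro that[of "max 1 R"]) auto
  qed
  define \<kappa> where "\<kappa> = 1 / P - a"
  have \<kappa>: "0 < \<kappa>" unfolding \<kappa>_def using P(2,3) by (simp add: field_simps)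
  have q: "0 < q x" "q x \<le> 1 / \<kappa>" "1 / q x = 1 / p x - a" "1 \<le> q x" "q x = 1 / (1 / p x - a)" if x: "x \<in> \<Omega>" for x
  proof -
    show eq: "1 / q x = 1 / p x - a" using assms(13) x unfolding a_def by blast
    have "1 / P \<le> 1 / p x" using P(1)[OF x] p_ge[OF x] by (intro divide_left_mono) auto
    then have ge: "\<kappa> \<le> 1 / q x" unfolding eq \<kappa>_def by simp
    then have "0 < 1 / q x" using \<kappa> by linarith
    then show q0: "0 < q x" by simp
    show "q x \<le> 1 / \<kappa>" using ge q0 \<kappa> by (simp add: field_simps)
    have "1 / p x \<le> 1" using p_ge[OF x] by simp
    then have "1 / q x \<le> 1" using eq a by linarith
    then show "1 \<le> q x" using q0 by simp
    show "q x = 1 / (1 / p x - a)" unfolding eq[symmetric] by simp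
  qed
  have s: "s x = q x * (1 - a)" "1 \<le> s x" "s x \<le> 1 / \<kappa>" if x: "x \<in> \<Omega>" for x
  proof -
    have "1 / p' x = 1 - 1 / p x" using assms(12) x by (simp add: algebra_simps)
    then have sx: "s x = 1 + q x * (1 - 1 / p x)" using assms(14) x by (metis divide_inverse inverse_eq_divide)
    also have "1 / p x = 1 / q x + a" using q(3)[OF x] by simp
    also have "1 + q x * (1 - (1 / q x + a)) = q x * (1 - a)" using q(1)[OF x] by (simp add: algebra_simps)
    finally show eq: "s x = q x * (1 - a)" .
    have "1 / p x \<le> 1" using p_ge[OF x] by simp
    then show "1 \<le> s x" unfolding sx using q(1)[OF x] by simp
    have "q x * (1 - a) \<le> q x * 1" using q(1)[OF x] a by (intro mult_left_mono) auto
    then show "s x \<le> 1 / \<kappa>" unfolding eq using q(2)[OF x] by linarith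
  qed
  have hoelder: "log_hoelder_on \<Omega> s"
    using log_hoelder_sobolev_exponent[OF assms(9) p_ge a, of q "1 / \<kappa>" s] q s by blast

  show ?thesis
  proof (cases "emeasure \<mu> \<Omega> = 0")
    case True
    then have "\<Omega> \<in> null_sets \<mu>" using \<Omega> by blast
    then have "lux_norm \<mu> q E h = 0" for h by (rule lux_norm_null[OF E(1)])
    then show ?thesis unfolding E_def[symmetric] by (intro exI[of _ 1]) simp
  next
    case False
    \<comment> \<open>The data are extended to measurable functions on the whole space, and \<open>V\<close> is made positive
      everywhere; it agrees with \<open>w\<close> to the power \<open>q\<close> almost everywhere on \<open>\<Omega>\<close>.\<close>
    define p1 where "p1 y = (if y \<in> \<Omega> then p y else 1)" for y
    define w1 where "w1 y = (if y \<in> \<Omega> then w y else 1)" for y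
    define q1 where "q1 y = 1 / (1 / p1 y - a)" for y
    define s1 where "s1 y = q1 y * (1 - a)" for y
    define V where "V y = (if 0 < w1 y then w1 y powr q1 y else 1)" for y
    have [measurable]: "p1 \<in> borel_measurable \<mu>"
      using assms(8) \<Omega> unfolding exponent_on_def p1_def by (subst (asm) measurable_restrict_space_iff[where c = 1]) auto
    have [measurable]: "w1 \<in> borel_measurable \<mu>"
      using assms(18) \<Omega> unfolding weight_on_def w1_def by (subst (asm) measurable_restrict_space_iff[where c = 1]) auto
    have [measurable]: "q1 \<in> borel_measurable \<mu>" unfolding q1_def by measurable
    have s1 [measurable]: "s1 \<in> borel_measurable \<mu>" unfolding s1_def by measurable
    have V [measurable]: "V \<in> borel_measurable \<mu>" unfolding V_def by measurable
    have q1_eq: "q1 y = q y" if "y \<in> \<Omega>" for y unfolding q1_def p1_def using q(5)[OF that] that by simp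
    have s1s: "s1 y = s y" if "y \<in> \<Omega>" for y unfolding s1_def using q1_eq s(1) that by simp
    have V0: "0 < V y" for y unfolding V_def by simp
    have wpos: "AE y in \<mu>. y \<in> \<Omega> \<longrightarrow> 0 < w y" using assms(18) unfolding weight_on_def by blast
    have Vw: "V y = w y powr q y" if "y \<in> \<Omega>" "0 < w y" for y
      unfolding V_def w1_def using that q1_eq by simp
    have E_meas [measurable]: "E \<in> sets \<mu>"
    proof -
      have "{y \<in> space \<mu>. r < s1 y} \<in> sets \<mu>" by measurable
      then have "\<Omega> \<inter> {y. r < s1 y} \<in> sets \<mu>" using sp by simp
      also have "\<Omega> \<inter> {y. r < s1 y} = superlevel \<Omega> s r" unfolding superlevel_def using s1s by auto
      finally have "superlevel \<Omega> s r \<in> sets \<mu>" .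
      moreover have "(\<Union>x\<in>\<Omega> - superlevel \<Omega> s r. ball x \<epsilon>) \<in> sets \<mu>"
        by (intro open_in_sets[OF \<mu>] open_UN) auto
      ultimately show ?thesis unfolding E_def superlevel_eps_def by (rule sets.Diff)
    qed
    obtain \<delta> where \<delta>: "0 < \<delta>" "\<delta> \<le> r - 1" "muckenhoupt \<mu> \<Omega> (r - \<delta>) (\<lambda>x. w x powr q x)"
      using assms(19) by blast
    define \<sigma> where "\<sigma> = r - \<delta>"
    have \<sigma>: "1 \<le> \<sigma>" "\<sigma> < r" unfolding \<sigma>_def using \<delta> by auto
    have muck: "muckenhoupt \<mu> \<Omega> \<sigma> V"
    proof (rule muckenhoupt_cong_AE[OF \<delta>(3)[folded \<sigma>_def]])
      show "V \<in> borel_measurable (restrict_space \<mu> \<Omega>)" by (rule measurable_restrict_space1[OF V])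
      show "AE y in \<mu>. y \<in> \<Omega> \<longrightarrow> w y powr q y = V y" using wpos by eventually_elim (auto simp: Vw)
    qed
    define \<nu> where "\<nu> = weight_measure \<mu> \<Omega> V"
    have \<nu>: "sets borel \<subseteq> sets \<nu>" "sets \<nu> = sets \<mu>" unfolding \<nu>_def using \<mu> by simp_all
    have fin\<nu>: "finite_measure \<nu>" unfolding \<nu>_def by (rule finite_weight_measure[OF \<mu> \<Omega> bdd fin \<sigma>(1) V V0 muck])
    define N where "N = measure \<nu> \<Omega>"
    have N: "emeasure \<nu> \<Omega> = ennreal N" "0 \<le> N"
      unfolding N_def using finite_measure.emeasure_eq_measure[OF fin\<nu>] by auto
    define t where "t = r / \<sigma>"
    have t: "1 < t" unfolding t_def using \<sigma> by simp
    obtain D where D: "0 \<le> D" "\<And>K. K \<in> borel_measurable \<nu> \<Longrightarrow> (\<And>y. 0 \<le> K y) \<Longrightarrow>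
        (\<integral>\<^sup>+x\<in>\<Omega>. epowr (centred_maximal \<nu> (\<lambda>y. ennreal (K y)) x) t \<partial>\<nu>)
          \<le> emeasure \<nu> \<Omega> + ennreal D * (\<integral>\<^sup>+y. ennreal (K y powr t) \<partial>\<nu>)"
      using strong_type[OF fin\<nu> \<nu>(1) bdd _ t] \<Omega> \<nu>(2) by blast
    have hoelder1: "log_hoelder_on \<Omega> s1" using hoelder s1s unfolding log_hoelder_on_def by simp
    have s1b: "1 \<le> s1 y \<and> s1 y \<le> 1 / \<kappa>" if "y \<in> \<Omega>" for y using s[OF that] s1s[OF that] by simp
    have rs1: "r \<le> s1 y" if "y \<in> E" for y using E(2)[OF that] s1s[of y] E(1) that by auto
    obtain B where B: "1 \<le> B" and point: "\<And>G x l. G \<in> borel_measurable \<mu> \<Longrightarrow> (\<And>y. 0 \<le> G y) \<Longrightarrow>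
        (\<And>y. y \<notin> E \<Longrightarrow> G y = 0) \<Longrightarrow> (\<integral>\<^sup>+y. ennreal (G y powr s1 y * V y) \<partial>\<mu>) \<le> 1 \<Longrightarrow> x \<in> E \<Longrightarrow> 0 < l \<Longrightarrow>
        \<exists>Y\<ge>0. (\<integral>\<^sup>+y\<in>cube x l. ennreal (G y) \<partial>\<mu>) = ennreal Y \<and>
          ennreal ((Y / measure \<mu> (cube x l)) powr s1 x) \<le>
            ennreal B * (1 + epowr (centred_maximal \<nu> (\<lambda>y. ennreal (large_power G s1 (\<sigma> / r) y)) x) t)"
      using variable_maximal_pointwise[OF \<mu> \<Omega> bdd False fin ahlfors \<beta> hoelder1 s1 s1b E(1) \<sigma> rs1 V V0 muck]
      unfolding \<nu>_def[symmetric] t_def[symmetric] by blast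
    define C where "C = B * (2 * N + D) + 1"
    have C: "1 \<le> C" unfolding C_def using B N(2) D(1) by simp
    \<comment> \<open>The summand \<open>1\<close> in \<open>C\<close> ensures \<open>1 \<le> C\<close>, so that \<open>C powr q x \<ge> C\<close>.\<close>
    have "modular \<mu> q E (\<lambda>x. ennreal (w x) * frac_maximal \<mu> \<beta> \<alpha> f x / ennreal (C * c)) \<le> 1"
      if wf: "(\<lambda>x. w x * f x) \<in> borel_measurable \<mu>" and supp: "{x. f x \<noteq> 0} \<subseteq> E" and c: "0 < c"
        and mod: "modular \<mu> p E (\<lambda>x. ennreal \<bar>w x * f x\<bar> / ennreal c) \<le> 1" for f c
    proof -
      note [measurable] = wf
      define F where "F y = (if y \<in> E then \<bar>w y * f y / c\<bar> powr p1 y / V y else 0)" for y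
      have "(\<lambda>y. if y \<in> E then \<bar>(w y * f y) / c\<bar> powr p1 y / V y else 0) \<in> borel_measurable \<mu>" by measurable
      then have [measurable]: "F \<in> borel_measurable \<mu>" unfolding F_def .
      have F0: "0 \<le> F y" for y unfolding F_def using V0[of y] by simp
      define G where "G y = F y powr (1 / s1 y)" for y
      have G [measurable]: "G \<in> borel_measurable \<mu>" unfolding G_def by measurable
      have G0: "0 \<le> G y" for y unfolding G_def by simp
      have GE: "G y = 0" if "y \<notin> E" for y using that unfolding G_def F_def by simp
      have Gs: "G y powr s1 y = F y" for y
      proof (cases "y \<in> E")
        case True
        then have "s1 y \<noteq> 0" using s1b[of y] E(1) by force
        then show ?thesis unfolding G_def using F0[of y] by (simp add: powr_powr)
      qed (simp add: GE F_def)
      have FV: "(\<integral>\<^sup>+y. ennreal (F y * V y) \<partial>\<mu>) \<le> 1"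
      proof -
        have "(\<integral>\<^sup>+y. ennreal (F y * V y) \<partial>\<mu>) = modular \<mu> p E (\<lambda>x. ennreal \<bar>w x * f x\<bar> / ennreal c)"
          unfolding modular_def
        proof (rule nn_integral_cong)
          fix y
          show "ennreal (F y * V y) = epowr (ennreal \<bar>w y * f y\<bar> / ennreal c) (p y) * indicator E y"
            using V0[of y] c E(1) by (cases "y \<in> E") (auto simp: F_def p1_def divide_ennreal abs_divide)
        qed
        then show ?thesis using mod by simp
      qed
      have GV: "(\<integral>\<^sup>+y. ennreal (G y powr s1 y * V y) \<partial>\<mu>) \<le> 1" using FV by (simp add: Gs)
      have fact: "AE y in \<mu>. \<bar>f y\<bar> = c * ((F y * V y) powr (\<alpha> / \<beta>) * G y powr (1 - \<alpha> / \<beta>))"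
        using wpos
      proof eventually_elim
        case (elim y)
        show ?case
        proof (cases "y \<in> E")
          case True
          then have y: "y \<in> \<Omega>" "0 < w y" using E(1) elim by auto
          have "(F y * V y) powr a * (F y powr (1 / s y)) powr (1 - a) = \<bar>f y\<bar> / c"
          proof (rule fractional_factorisation[OF q(3)[OF y(1)] q(1)[OF y(1)] _ s(1)[OF y(1)] _ y(2) _ Vw[OF y]])
            show "0 < p y" "0 < s y" using p_ge[OF y(1)] s(2)[OF y(1)] by simp_all
            show "F y = (w y * (\<bar>f y\<bar> / c)) powr p y / V y"
              unfolding F_def p1_def using True y c by (simp add: abs_mult abs_divide)
          qed (use c in simp)
          then show ?thesis using c unfolding G_def s1s[OF y(1)] a_def by simp
        next
          case False
          then have "f y = 0" using supp by blast
          then show ?thesis using GE[OF False] by simp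
        qed
      qed
      define K where "K y = large_power G s1 (\<sigma> / r) y" for y
      have [measurable]: "K \<in> borel_measurable \<mu>" unfolding K_def large_power_def by measurable
      have K: "K \<in> borel_measurable \<nu>" using \<nu>(2) by (simp cong: measurable_cong_sets)
      have K0: "0 \<le> K y" for y unfolding K_def large_power_def by simp
      define M where "M = centred_maximal \<nu> (\<lambda>y. ennreal (K y))"
      have M\<nu>: "M \<in> borel_measurable \<nu>"
        unfolding M_def
        by (intro measurable_centred_maximal[OF fin\<nu> \<nu>(1)] measurable_compose[OF K measurable_ennreal])
      then have [measurable]: "M \<in> borel_measurable \<mu>" using \<nu>(2) by (simp cong: measurable_cong_sets)
      define T where "T x = ennreal B * (1 + epowr (M x) t)" for x
      have T [measurable]: "T \<in> borel_measurable \<mu>" unfolding T_def by measurable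
      have pw: "epowr (ennreal (w x) * frac_maximal \<mu> \<beta> \<alpha> f x / ennreal (C * c)) (q x) \<le> ennreal (1 / C) * (ennreal (V x) * T x)"
        if x: "x \<in> E" "0 < w x" for x
      proof (cases "T x")
        case top
        then show ?thesis using C V0[of x] by (simp add: ennreal_mult_top)
      next
        case (real \<tau>)
        have x\<Omega>: "x \<in> \<Omega>" using x E(1) by blast
        have "frac_maximal \<mu> \<beta> \<alpha> f x \<le> ennreal (c * \<tau> powr (1 / q x))"
        proof (rule scaled_fractional_maximal_le[OF \<mu> _ _ _ c q(1)[OF x\<Omega>] s(1)[OF x\<Omega>, unfolded a_def] _ _ FV G G0 fact])
          show "\<exists>Y\<ge>0. (\<integral>\<^sup>+y\<in>cube x l. ennreal (G y) \<partial>\<mu>) = ennreal Y \<and>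
            ennreal ((Y / measure \<mu> (cube x l)) powr s x) \<le> ennreal \<tau>" if "0 < l" for l
            using point[OF G G0 GE GV x(1) that] real(2) unfolding T_def M_def K_def s1s[OF x\<Omega>] by simp
          show "0 \<le> F y * V y" for y using F0[of y] V0[of y] by simp
        qed (use fin x\<Omega> a real(1) in \<open>auto simp: a_def\<close>)
        then have "ennreal (w x) * frac_maximal \<mu> \<beta> \<alpha> f x / ennreal (C * c) \<le> ennreal (w x) * ennreal (c * \<tau> powr (1 / q x)) / ennreal (C * c)"
          by (intro divide_right_mono_ennreal mult_left_mono) auto
        also have "\<dots> = ennreal (w x * (c * \<tau> powr (1 / q x)) / (C * c))"
          using x(2) c C by (simp add: ennreal_mult'[symmetric] divide_ennreal)
        also have "w x * (c * \<tau> powr (1 / q x)) / (C * c) = w x * \<tau> powr (1 / q x) / C" using c by simp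
        finally have "epowr (ennreal (w x) * frac_maximal \<mu> \<beta> \<alpha> f x / ennreal (C * c)) (q x) \<le> epowr (ennreal (w x * \<tau> powr (1 / q x) / C)) (q x)"
          using q(1)[OF x\<Omega>] by (intro epowr_mono) auto
        also have "\<dots> = ennreal ((w x * \<tau> powr (1 / q x) / C) powr q x)" using x C by (intro epowr_ennreal) auto
        also have "(w x * \<tau> powr (1 / q x) / C) powr q x = V x * \<tau> / C powr q x"
          using Vw[OF x\<Omega> x(2)] q(1)[OF x\<Omega>] real(1) by (simp add: powr_mult powr_divide powr_powr)
        also have "\<dots> \<le> V x * \<tau> / C"
        proof (rule divide_left_mono)
          have "C powr 1 \<le> C powr q x" using C q(4)[OF x\<Omega>] by (intro powr_mono) auto
          then show "C \<le> C powr q x" using C by simp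
        qed (use C V0[of x] real(1) in auto)
        finally have "epowr (ennreal (w x) * frac_maximal \<mu> \<beta> \<alpha> f x / ennreal (C * c)) (q x) \<le> ennreal (V x * \<tau> / C)"
          by (simp add: ennreal_leI)
        also have "ennreal (V x * \<tau> / C) = ennreal (1 / C) * (ennreal (V x) * T x)"
          using real C V0[of x] by (simp add: ennreal_mult[symmetric])
        finally show ?thesis .
      qed
      have "modular \<mu> q E (\<lambda>x. ennreal (w x) * frac_maximal \<mu> \<beta> \<alpha> f x / ennreal (C * c))
          \<le> (\<integral>\<^sup>+x. ennreal (1 / C) * (ennreal (V x) * T x * indicator \<Omega> x) \<partial>\<mu>)"
        unfolding modular_def
      proof (rule nn_integral_mono_AE)
        show "AE x in \<mu>. epowr (ennreal (w x) * frac_maximal \<mu> \<beta> \<alpha> f x / ennreal (C * c)) (q x) * indicator E x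
            \<le> ennreal (1 / C) * (ennreal (V x) * T x * indicator \<Omega> x)"
          using wpos
        proof eventually_elim
          case (elim x)
          show ?case
          proof (cases "x \<in> E")
            case True
            then have "x \<in> \<Omega>" using E(1) by blast
            then show ?thesis using True pw[OF True] elim by simp
          qed simp
        qed
      qed
      also have "\<dots> = ennreal (1 / C) * (\<integral>\<^sup>+x\<in>\<Omega>. ennreal (V x) * T x \<partial>\<mu>)" by (rule nn_integral_cmult) measurable
      finally have le: "modular \<mu> q E (\<lambda>x. ennreal (w x) * frac_maximal \<mu> \<beta> \<alpha> f x / ennreal (C * c))
          \<le> ennreal (1 / C) * (\<integral>\<^sup>+x\<in>\<Omega>. ennreal (V x) * T x \<partial>\<mu>)" .
      have "(\<integral>\<^sup>+x\<in>\<Omega>. ennreal (V x) * T x \<partial>\<mu>) = (\<integral>\<^sup>+x\<in>\<Omega>. T x \<partial>\<nu>)"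
        unfolding \<nu>_def by (subst nn_integral_weight_measure) (auto intro!: nn_integral_cong simp: indicator_def)
      also have "\<dots> = ennreal B * (\<integral>\<^sup>+x. indicator \<Omega> x + epowr (M x) t * indicator \<Omega> x \<partial>\<nu>)"
        using M\<nu> \<Omega> \<nu>(2) unfolding T_def
        by (subst nn_integral_cmult[symmetric]) (auto intro!: nn_integral_cong simp: distrib_left distrib_right mult.assoc)
      also have "\<dots> = ennreal B * (emeasure \<nu> \<Omega> + (\<integral>\<^sup>+x\<in>\<Omega>. epowr (M x) t \<partial>\<nu>))"
        using M\<nu> \<Omega> \<nu>(2) by (subst nn_integral_add) auto
      also have "\<dots> \<le> ennreal B * (ennreal N + (ennreal N + ennreal D * 1))"
      proof -
        have "(\<integral>\<^sup>+y. ennreal (K y powr t) \<partial>\<nu>) = (\<integral>\<^sup>+y\<in>\<Omega>. ennreal (V y) * ennreal (K y powr t) \<partial>\<mu>)"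
          unfolding \<nu>_def by (rule nn_integral_weight_measure) auto
        also have "\<dots> \<le> (\<integral>\<^sup>+y. ennreal (G y powr s1 y * V y) \<partial>\<mu>)"
        proof (rule nn_integral_mono)
          fix y
          have "(\<sigma> / r * s1 y) * t = s1 y" unfolding t_def using \<sigma> by simp
          then have "K y powr t \<le> G y powr s1 y" unfolding K_def large_power_def by (simp add: powr_powr)
          then have "V y * K y powr t \<le> G y powr s1 y * V y" using V0[of y] by (simp add: mult.commute)
          then show "ennreal (V y) * ennreal (K y powr t) * indicator \<Omega> y \<le> ennreal (G y powr s1 y * V y)"
            using V0[of y] by (auto simp: indicator_def ennreal_mult[symmetric] intro!: ennreal_leI)
        qed
        also have "\<dots> \<le> 1" by (rule GV)
        finally have "ennreal D * (\<integral>\<^sup>+y. ennreal (K y powr t) \<partial>\<nu>) \<le> ennreal D * 1" by (rule mult_left_mono) simp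
        then have "(\<integral>\<^sup>+x\<in>\<Omega>. epowr (M x) t \<partial>\<nu>) \<le> ennreal N + ennreal D * 1"
          using D(2)[OF K K0] unfolding M_def N(1) by (meson add_left_mono order_trans)
        then show ?thesis unfolding N(1) by (intro mult_left_mono add_left_mono) auto
      qed
      also have "\<dots> = ennreal (C - 1)"
        unfolding C_def using B N(2) D(1) by (simp add: ennreal_mult[symmetric] ennreal_plus[symmetric] del: ennreal_plus)
      finally have "ennreal (1 / C) * (\<integral>\<^sup>+x\<in>\<Omega>. ennreal (V x) * T x \<partial>\<mu>) \<le> ennreal (1 / C) * ennreal (C - 1)"
        by (rule mult_left_mono) simp
      also have "\<dots> = ennreal (1 / C * (C - 1))" using C by (intro ennreal_mult[symmetric]) auto
      also have "1 / C * (C - 1) \<le> 1" using C by (simp add: divide_le_eq)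
      then have "ennreal (1 / C * (C - 1)) \<le> 1" by (simp only: ennreal_le_1)
      finally show ?thesis using le by (rule order_trans[rotated])
    qed
    then show ?thesis
      unfolding E_def[symmetric] using C by (intro exI[of _ C]) (auto simp: Lp_var_def intro!: lux_norm_transfer)
  qed
qed

end
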